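(* Let $(A(t),B(t))_{t\ge0}$ be the continuous-time fast embedding of the simple harmonic urn and let $\tau_f=\inf\{t\ge0:A(t)=0\}$. Let $n\in\mathbb N$ and write $\mathbb E_n$ for expectation given $A(0)=n$, $B(0)=0$. For any $\delta>0$, as $n\to\infty$, $$\mathbb E_n[\tau_f]=\pi/2+O\bigl(n^{\delta-(1/2)}\bigr),$$ $$\mathbb E_n\bigl[|\tau_f-(\pi/2)|^2\bigr]=O\bigl(n^{\delta-(1/2)}\bigr).$$
   Context: $\operatorname{sgn}(x)=-1,0,1$ according as $x<0$, $x=0$, $x>0$. The fast embedding $(A(t),B(t))_{t\ge0}$ is the continuous-time Markov chain on $\mathbb Z^2\setminus\{(0,0)\}$ which from state $(a,b)$ jumps to $(a-\operatorname{sgn}(b),b)$ at rate $|b|$ and to $(a,b+\operatorname{sgn}(a))$ at rate $|a|$. (It does not explode in finite time.) *)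

theory Defs
  imports "HOL-Probability.Probability" "HOL-Library.Landau_Symbols"
begin

text \<open>Jump rates \<open>q x y\<close> are given for \<open>x \<noteq> y\<close> only; diagonal values are ignored.\<close>

definition exit_rate :: "'s set \<Rightarrow> ('s \<Rightarrow> 's \<Rightarrow> real) \<Rightarrow> 's \<Rightarrow> real" where
  "exit_rate E q x = (\<Sum>\<^sub>\<infinity>y\<in>E - {x}. q x y)"

definition jump_prob :: "'s set \<Rightarrow> ('s \<Rightarrow> 's \<Rightarrow> real) \<Rightarrow> 's \<Rightarrow> 's \<Rightarrow> real" where
  "jump_prob E q x y = (if y = x then 0 else q x y / exit_rate E q x)"

text \<open>
  Continuous-time Markov chain on the countable state space \<open>E\<close> with jump rates \<open>q\<close>, started
  at \<open>x0\<close>, in jump chain/holding time form: \<open>Y\<close> is the sequence of visited states and \<open>S k\<close> the time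
  spent in \<open>Y k\<close>. The last clause says that \<open>Y\<close> is a Markov chain from \<open>x0\<close> with transition
  probabilities \<open>jump_prob E q\<close>, and that given \<open>Y\<close> the holding times are independent, \<open>S k\<close> being
  exponential with parameter \<open>exit_rate E q (Y k)\<close>. It is meant for chains without absorbing
  states, that is, with positive exit rates throughout \<open>E\<close>. Beyond a possible explosion time
  \<open>X\<close> is unconstrained.
\<close>

definition ctmc_from ::
  "'w measure \<Rightarrow> 's set \<Rightarrow> ('s \<Rightarrow> 's \<Rightarrow> real) \<Rightarrow> 's \<Rightarrow> (real \<Rightarrow> 'w \<Rightarrow> 's) \<Rightarrow> bool" where
  "ctmc_from M E q x0 X \<longleftrightarrow>
     prob_space M \<and>
     (\<forall>t\<ge>0. X t \<in> measurable M (count_space E)) \<and>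
     (\<exists>(Y :: nat \<Rightarrow> 'w \<Rightarrow> 's) (S :: nat \<Rightarrow> 'w \<Rightarrow> real).
        (\<forall>k. Y k \<in> measurable M (count_space E)) \<and>
        (\<forall>k. S k \<in> borel_measurable M) \<and>
        (AE \<omega> in M. \<forall>k t. (\<Sum>i<k. S i \<omega>) \<le> t \<and> t < (\<Sum>i<Suc k. S i \<omega>) \<longrightarrow> X t \<omega> = Y k \<omega>) \<and>
        (\<forall>k (y :: nat \<Rightarrow> 's) (s :: nat \<Rightarrow> real).
           (\<forall>i\<le>k. y i \<in> E) \<longrightarrow> (\<forall>i<k. 0 \<le> s i) \<longrightarrow>
           measure M {\<omega> \<in> space M. (\<forall>i\<le>k. Y i \<omega> = y i) \<and> (\<forall>i<k. s i < S i \<omega>)} =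
             (if y 0 = x0 then 1 else 0) *
             (\<Prod>i<k. jump_prob E q (y i) (y (Suc i)) * exp (- exit_rate E q (y i) * s i))))"

definition urn_states :: "(int \<times> int) set" where
  "urn_states = UNIV - {(0, 0)}"

definition urn_rate :: "int \<times> int \<Rightarrow> int \<times> int \<Rightarrow> real" where
  "urn_rate = (\<lambda>(a, b) y.
     (if y = (a - sgn b, b) then real_of_int \<bar>b\<bar> else 0) +
     (if y = (a, b + sgn a) then real_of_int \<bar>a\<bar> else 0))"

definition fast_embedding ::
  "'w measure \<Rightarrow> int \<times> int \<Rightarrow> (real \<Rightarrow> 'w \<Rightarrow> int) \<Rightarrow> (real \<Rightarrow> 'w \<Rightarrow> int) \<Rightarrow> bool" where
  "fast_embedding M x0 A B \<longleftrightarrow>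
     ctmc_from M urn_states urn_rate x0 (\<lambda>t \<omega>. (A t \<omega>, B t \<omega>))"

text \<open>Taken in the extended reals, so that the value is \<open>\<infinity>\<close> if zero is never reached.\<close>

definition tau_f :: "(real \<Rightarrow> 'w \<Rightarrow> int) \<Rightarrow> 'w \<Rightarrow> ereal" where
  "tau_f A \<omega> = Inf (ereal ` {t. 0 \<le> t \<and> A t \<omega> = 0})"

text \<open>Expectation of a random variable with values in \<open>[0, \<infinity>]\<close>.\<close>

definition expect :: "'w measure \<Rightarrow> ('w \<Rightarrow> ereal) \<Rightarrow> ennreal" where
  "expect M Z = (\<integral>\<^sup>+\<omega>. e2ennreal (Z \<omega>) \<partial>M)"

lemma exit_rate_urn:
  assumes "(a, b) \<in> urn_states"
  shows "exit_rate urn_states urn_rate (a, b) = real_of_int (\<bar>a\<bar> + \<bar>b\<bar>)"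
proof -
  let ?F = "{(a - sgn b, b), (a, b + sgn a)} - {(a, b)}"
  have ab: "a \<noteq> 0 \<or> b \<noteq> 0"
    using assms by (auto simp: urn_states_def)
  have "exit_rate urn_states urn_rate (a, b) =
      infsum (urn_rate (a, b)) (urn_states - {(a, b)})"
    by (simp add: exit_rate_def)
  also have "\<dots> = infsum (urn_rate (a, b)) ?F"
    by (rule infsum_cong_neutral)
       (use ab in \<open>auto simp: urn_rate_def urn_states_def sgn_if split: if_splits\<close>)
  also have "\<dots> = sum (urn_rate (a, b)) ?F"
    by (simp add: infsum_finite)
  also have "\<dots> = real_of_int (\<bar>a\<bar> + \<bar>b\<bar>)"
  proof -
    consider "a = 0" "b \<noteq> 0" | "a \<noteq> 0" "b = 0" | "a \<noteq> 0" "b \<noteq> 0"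
      using ab by blast
    then show ?thesis
    proof cases
      case 1
      then have "?F = {(a - sgn b, b)}" by (auto simp: sgn_if)
      with 1 show ?thesis by (simp add: urn_rate_def sgn_if)
    next
      case 2
      then have "?F = {(a, b + sgn a)}" by (auto simp: sgn_if)
      with 2 show ?thesis by (simp add: urn_rate_def sgn_if)
    next
      case 3
      then have "?F = {(a - sgn b, b), (a, b + sgn a)}" by (auto simp: sgn_if)
      with 3 show ?thesis by (simp add: urn_rate_def sgn_if)
    qed
  qed
  finally show ?thesis .
qed

end

theory Submission
  imports Defs "HOL-Real_Asymp.Real_Asymp"
begin

text \<open>
  It suffices to show that \<open>\<tau>\<close> satisfies \<open>E (\<tau> - \<pi>/2)\<^sup>2 \<le> C / n\<close>, since then \<open>\<bar>E \<tau> - \<pi>/2\<bar>\<close> is at most of order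
  \<open>n powr (- 1/2)\<close> by the Cauchy-Schwarz inequality.

  Let \<open>L\<close> be the generator in the first quadrant. It suffices to find a function \<open>F (t, a, b) \<ge> 0\<close> with
  \<open>\<partial>\<^sub>t F + L F \<le> 0\<close>, with \<open>F (t, 0, b) \<ge> (t - \<pi>/2)\<^sup>2\<close> and with \<open>F (0, n, 0) \<le> C / n\<close>: stopped at \<open>\<tau>\<close>, it is a
  supermartingale. Up to time \<open>\<pi>\<close> we use that \<open>W\<^sub>t = (A + i B) exp (- i t)\<close> is a martingale: \<open>\<bar>W - n\<bar>\<^sup>2\<close> has
  drift \<open>a + b\<close>, which is of order \<open>n\<close> and is compensated by a term linear in \<open>a + b\<close>, and its value is at least
  \<open>n\<^sup>2 cos\<^sup>2 t\<close> on \<open>a = 0\<close> and at least \<open>n\<^sup>2\<close> at time \<open>\<pi>\<close> if \<open>a \<ge> 0\<close>. Hence \<open>\<bar>W - n\<bar>\<^sup>2 / n\<^sup>2\<close>, up to a constant factor,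
  dominates both \<open>(t - \<pi>/2)\<^sup>2\<close> on the boundary and any bounded function at time \<open>\<pi>\<close>. From time \<open>\<pi>\<close> on
  a quadratic polynomial in \<open>t\<close> suffices, whose coefficients are multiples of \<open>G = 12 a / (a + b + 1)\<close>: this
  function is bounded and satisfies \<open>L G \<le> - 1\<close>. Along the jump chain \<open>G\<close> decreases on average by at
  least \<open>1 / (n + k)\<close> in the \<open>k\<close>-th step, so that the divergence of the harmonic series makes \<open>\<tau>\<close> finite.
\<close>

section \<open>Jump chains with exponential holding times\<close>

abbreviation exp_law :: "real \<Rightarrow> real measure" where
  "exp_law l \<equiv> density lborel (exponential_density l)"

text \<open>The form with \<open>max x 0\<close> covers negative endpoints, where the half-line has
  full mass: measures are compared on all half-lines below, while \<open>law\<close> only allows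
  nonnegative thresholds.\<close>

lemma emeasure_exp_law_greaterThan:
  assumes "0 < l"
  shows "emeasure (exp_law l) {x<..} = ennreal (exp (- l * max x 0))"
proof -
  interpret prob_space "exp_law l" by (rule prob_space_exponential_density) fact
  have D: "distributed (exp_law l) lborel (\<lambda>x. x) (exponential_density l)"
    unfolding distributed_def by (auto intro!: distr_id2)
  have *: "prob {x<..} = exp (- l * x)" if "0 \<le> x" for x
    using exponential_distributedD_gt[OF D that assms] by (simp add: greaterThan_def mult.commute)
  show ?thesis
  proof (cases "0 \<le> x")
    case True
    then show ?thesis by (simp add: emeasure_eq_measure *)
  next
    case False
    then have "prob {0<..} \<le> prob {x<..}" by (intro finite_measure_mono) auto
    with *[of 0] have "prob {x<..} = 1" by (intro antisym prob_le_1) simp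
    with False show ?thesis by (simp add: emeasure_eq_measure)
  qed
qed

text \<open>The level sets of \<open>X\<close> form a countable partition, so integrals may be
  compared piece by piece. With \<open>X\<close> the history of the chain this takes the place of
  conditioning on the past.\<close>

lemma (in finite_measure) nn_integral_eqI_countable:
  fixes X :: "'a \<Rightarrow> 'b :: countable"
  assumes [measurable]: "X \<in> measurable M (count_space UNIV)"
    "f \<in> borel_measurable M" "g \<in> borel_measurable M"
    and eq: "\<And>i. (\<integral>\<^sup>+\<omega>. f \<omega> * indicator {\<omega>. X \<omega> = i} \<omega> \<partial>M) = (\<integral>\<^sup>+\<omega>. g \<omega> * indicator {\<omega>. X \<omega> = i} \<omega> \<partial>M)"
  shows "(\<integral>\<^sup>+\<omega>. f \<omega> \<partial>M) = (\<integral>\<^sup>+\<omega>. g \<omega> \<partial>M)"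
proof -
  have *: "(\<integral>\<^sup>+\<omega>. h \<omega> \<partial>M) = (\<integral>\<^sup>+i. (\<integral>\<^sup>+\<omega>. h \<omega> * indicator {\<omega>. X \<omega> = i} \<omega> \<partial>M) \<partial>count_space UNIV)"
    if [measurable]: "h \<in> borel_measurable M" for h
  proof -
    have "(\<integral>\<^sup>+\<omega>. h \<omega> \<partial>M) = (\<integral>\<^sup>+\<omega>. (\<integral>\<^sup>+i. h \<omega> * indicator {X \<omega>} i \<partial>count_space UNIV) \<partial>M)"
      by simp
    also have "\<dots> = (\<integral>\<^sup>+\<omega>. (\<integral>\<^sup>+i. h \<omega> * indicator {\<omega>. X \<omega> = i} \<omega> \<partial>count_space UNIV) \<partial>M)"
      by (intro nn_integral_cong) (auto split: split_indicator)
    also have "\<dots> = (\<integral>\<^sup>+i. (\<integral>\<^sup>+\<omega>. h \<omega> * indicator {\<omega>. X \<omega> = i} \<omega> \<partial>M) \<partial>count_space UNIV)"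
      by (rule nn_integral_count_space_nn_integral) auto
    finally show ?thesis .
  qed
  show ?thesis
    unfolding *[OF \<open>f \<in> borel_measurable M\<close>] *[OF \<open>g \<in> borel_measurable M\<close>] eq ..
qed

section \<open>Jump chain, holding times and jump times\<close>

text \<open>The data of \<open>ctmc_from\<close> with the witnesses \<open>Y\<close> and
  \<open>S\<close> fixed and the process \<open>X\<close> left out. The last three assumptions say
  that no state is absorbing and that \<open>jump_prob\<close> is a stochastic matrix on
  \<open>E\<close>.\<close>

locale jump_chain = prob_space M for M :: "'w measure" +
  fixes E :: "'s::countable set" and q :: "'s \<Rightarrow> 's \<Rightarrow> real" and x0 :: 's
    and Y :: "nat \<Rightarrow> 'w \<Rightarrow> 's" and S :: "nat \<Rightarrow> 'w \<Rightarrow> real"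
  assumes x0_E: "x0 \<in> E"
    and Y_E: "Y k \<in> measurable M (count_space E)"
    and S_measurable[measurable]: "S k \<in> borel_measurable M"
    and law: "(\<And>i. i \<le> k \<Longrightarrow> y i \<in> E) \<Longrightarrow> (\<And>i. i < k \<Longrightarrow> 0 \<le> s i) \<Longrightarrow>
       measure M {\<omega> \<in> space M. (\<forall>i\<le>k. Y i \<omega> = y i) \<and> (\<forall>i<k. s i < S i \<omega>)} =
         (if y 0 = x0 then 1 else 0) *
         (\<Prod>i<k. jump_prob E q (y i) (y (Suc i)) * exp (- exit_rate E q (y i) * s i))"
    and rate_pos: "x \<in> E \<Longrightarrow> 0 < exit_rate E q x"
    and jump_nonneg: "x \<in> E \<Longrightarrow> z \<in> E \<Longrightarrow> 0 \<le> jump_prob E q x z"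
    and jump_total: "x \<in> E \<Longrightarrow> (\<integral>\<^sup>+z. ennreal (jump_prob E q x z) \<partial>count_space E) = 1"
begin

definition T :: "nat \<Rightarrow> 'w \<Rightarrow> real" where "T k \<omega> = (\<Sum>i<k. S i \<omega>)"

text \<open>Coded as a list because lists over a countable type are again countable, so that events
  can be split according to the whole past. Index \<open>k\<close> is included, hence the length
  \<open>Suc k\<close>.\<close>

definition hist :: "nat \<Rightarrow> 'w \<Rightarrow> 's list" where "hist k \<omega> = map (\<lambda>i. Y i \<omega>) [0..<Suc k]"

lemma Y_measurable[measurable]: "Y k \<in> measurable M (count_space UNIV)"
  by (rule measurable_compose[OF Y_E]) auto

lemma Y_in: "\<omega> \<in> space M \<Longrightarrow> Y k \<omega> \<in> E"
  using measurable_space[OF Y_E] by auto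

lemma T_measurable[measurable]: "T k \<in> borel_measurable M"
  unfolding T_def by measurable

lemma hist_eq_iff: "hist k \<omega> = l \<longleftrightarrow> length l = Suc k \<and> (\<forall>i\<le>k. Y i \<omega> = l ! i)"
  unfolding hist_def list_eq_iff_nth_eq by (auto simp: less_Suc_eq_le simp del: upt_Suc)

lemma hist_measurable[measurable]: "hist k \<in> measurable M (count_space UNIV)"
proof (rule measurable_count_space_eq2_countable[THEN iffD2], safe)
  fix l show "hist k -` {l} \<inter> space M \<in> sets M"
  proof -
    have "hist k -` {l} \<inter> space M = {\<omega> \<in> space M. length l = Suc k \<and> (\<forall>i\<le>k. Y i \<omega> = l ! i)}"
      by (auto simp: hist_eq_iff[symmetric])
    also have "\<dots> \<in> sets M" by measurable
    finally show ?thesis .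
  qed
qed auto

section \<open>The joint law of the path and the jump time\<close>

definition weight :: "nat \<Rightarrow> (nat \<Rightarrow> 's) \<Rightarrow> real" where
  "weight k y = (if y 0 = x0 then 1 else 0) * (\<Prod>i<k. jump_prob E q (y i) (y (Suc i)))"

lemma weight_nonneg: "(\<And>i. i \<le> k \<Longrightarrow> y i \<in> E) \<Longrightarrow> 0 \<le> weight k y"
  unfolding weight_def by (intro mult_nonneg_nonneg prod_nonneg) (auto intro!: jump_nonneg)

text \<open>The conditional law of \<open>T j\<close> given the path \<open>y\<close>: the
  convolution of the exponential laws of the first \<open>j\<close> holding times.\<close>

primrec sum_law :: "(nat \<Rightarrow> 's) \<Rightarrow> nat \<Rightarrow> real measure" where
  "sum_law y 0 = return borel 0"
| "sum_law y (Suc j) = distr (sum_law y j \<Otimes>\<^sub>M exp_law (exit_rate E q (y j))) borel (\<lambda>(t, s). t + s)"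

lemma sets_sum_law[simp, measurable_cong]: "sets (sum_law y j) = sets borel"
  by (cases j) auto

lemma prob_space_sum_law: "(\<And>i. i < j \<Longrightarrow> y i \<in> E) \<Longrightarrow> prob_space (sum_law y j)"
proof (induction j)
  case 0
  then show ?case by (auto intro: prob_space_return)
next
  case (Suc j)
  interpret A: prob_space "sum_law y j" using Suc by auto
  interpret B: prob_space "exp_law (exit_rate E q (y j))"
    using Suc by (intro prob_space_exponential_density rate_pos) auto
  interpret P: pair_prob_space "sum_law y j" "exp_law (exit_rate E q (y j))" ..
  show ?case by (simp, rule P.prob_space_distr) measurable
qed

lemma nn_integral_sum_law_Suc:
  assumes "\<And>i. i \<le> j \<Longrightarrow> y i \<in> E" and [measurable]: "f \<in> borel_measurable borel"
  shows "(\<integral>\<^sup>+t. f t \<partial>sum_law y (Suc j)) =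
    (\<integral>\<^sup>+t. (\<integral>\<^sup>+s. f (t + s) \<partial>exp_law (exit_rate E q (y j))) \<partial>sum_law y j)"
proof -
  interpret B: prob_space "exp_law (exit_rate E q (y j))"
    using assms by (intro prob_space_exponential_density rate_pos) auto
  have "(\<integral>\<^sup>+t. f t \<partial>sum_law y (Suc j)) =
      (\<integral>\<^sup>+z. f (fst z + snd z) \<partial>(sum_law y j \<Otimes>\<^sub>M exp_law (exit_rate E q (y j))))"
    by (simp add: nn_integral_distr split_beta')
  also have "\<dots> = (\<integral>\<^sup>+t. (\<integral>\<^sup>+s. f (t + s) \<partial>exp_law (exit_rate E q (y j))) \<partial>sum_law y j)"
    by (subst B.nn_integral_fst[symmetric]) auto
  finally show ?thesis .
qed

text \<open>The condition \<open>s i < S i\<close> is traded, one index at a time, for the law of the partial sum: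
  half-lines generate the Borel sets, so the tail probabilities determine the joint law of
  \<open>T j\<close> and \<open>S j\<close>.\<close>

lemma emeasure_T_path:
  assumes y: "\<And>i. i \<le> k \<Longrightarrow> y i \<in> E" and j: "j \<le> k" and A: "A \<in> sets borel"
    and s: "\<And>i. i < k \<Longrightarrow> 0 \<le> s i"
  shows "emeasure M {\<omega> \<in> space M. (\<forall>i\<le>k. Y i \<omega> = y i) \<and> (\<forall>i<j. 0 < S i \<omega>) \<and>
        (\<forall>i<k. j \<le> i \<longrightarrow> s i < S i \<omega>) \<and> T j \<omega> \<in> A} =
    ennreal (weight k y * (\<Prod>i=j..<k. exp (- exit_rate E q (y i) * s i))) * emeasure (sum_law y j) A"
  using j A s
proof (induction j arbitrary: A s)
  case 0
  have "emeasure M {\<omega> \<in> space M. (\<forall>i\<le>k. Y i \<omega> = y i) \<and> (\<forall>i<k. s i < S i \<omega>)} =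
      ennreal (weight k y * (\<Prod>i=0..<k. exp (- exit_rate E q (y i) * s i)))"
    using y 0 by (simp add: emeasure_eq_measure law weight_def prod.distrib atLeast0LessThan)
  moreover have "{\<omega> \<in> space M. (\<forall>i\<le>k. Y i \<omega> = y i) \<and> (\<forall>i<0. 0 < S i \<omega>) \<and>
        (\<forall>i<k. 0 \<le> i \<longrightarrow> s i < S i \<omega>) \<and> T 0 \<omega> \<in> A} =
      (if 0 \<in> A then {\<omega> \<in> space M. (\<forall>i\<le>k. Y i \<omega> = y i) \<and> (\<forall>i<k. s i < S i \<omega>)} else {})"
    by (auto simp: T_def)
  ultimately show ?case using 0 by (simp split: split_indicator)
next
  case (Suc j)
  note [measurable] = \<open>A \<in> sets borel\<close>
  let ?r = "exit_rate E q (y j)"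
  define c where "c = ennreal (weight k y * (\<Prod>i=Suc j..<k. exp (- exit_rate E q (y i) * s i)))"
  define Ev where "Ev = {\<omega> \<in> space M. (\<forall>i\<le>k. Y i \<omega> = y i) \<and> (\<forall>i<j. 0 < S i \<omega>) \<and> 0 < S j \<omega> \<and>
        (\<forall>i<k. Suc j \<le> i \<longrightarrow> s i < S i \<omega>)}"
  have [measurable]: "Ev \<in> sets M" unfolding Ev_def by measurable
  have w: "0 \<le> weight k y" using y by (rule weight_nonneg)
  have r: "0 < ?r" using Suc y by (intro rate_pos) auto
  interpret A: prob_space "sum_law y j" using Suc y by (intro prob_space_sum_law) auto
  interpret B: prob_space "exp_law ?r" using r by (rule prob_space_exponential_density)
  \<comment> \<open>The joint law of \<open>T j\<close> and \<open>S j\<close> on \<open>Ev\<close>,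
    to be identified as a product measure.\<close>
  define N where "N = distr (density M (indicator Ev)) (borel \<Otimes>\<^sub>M borel) (\<lambda>\<omega>. (T j \<omega>, S j \<omega>))"
  have half: "emeasure M (Ev \<inter> {\<omega>. T j \<omega> \<in> D} \<inter> {\<omega>. S j \<omega> \<in> H}) =
      c * emeasure (sum_law y j) D * emeasure (exp_law ?r) H"
    if D[measurable]: "D \<in> sets borel" and H[measurable]: "H \<in> sets borel" for D H
  proof -
    \<comment> \<open>For a fixed set \<open>D\<close> of values of \<open>T j\<close>, the law of
      \<open>S j\<close> alone is a finite measure and is determined by its tails.\<close>
    define N' where "N' = distr (density M (indicator (Ev \<inter> {\<omega>\<in>space M. T j \<omega> \<in> D}))) borel (S j)"
    have N': "emeasure N' H = emeasure M (Ev \<inter> {\<omega>. T j \<omega> \<in> D} \<inter> {\<omega>. S j \<omega> \<in> H})"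
      if [measurable]: "H \<in> sets borel" for H
    proof -
      have "emeasure N' H = (\<integral>\<^sup>+\<omega>. indicator (Ev \<inter> {\<omega>\<in>space M. T j \<omega> \<in> D}) \<omega> * indicator (S j -` H \<inter> space M) \<omega> \<partial>M)"
        unfolding N'_def by (simp add: emeasure_distr emeasure_density)
      also have "\<dots> = (\<integral>\<^sup>+\<omega>. indicator (Ev \<inter> {\<omega>\<in>space M. T j \<omega> \<in> D} \<inter> {\<omega>\<in>space M. S j \<omega> \<in> H}) \<omega> \<partial>M)"
        by (intro nn_integral_cong) (auto split: split_indicator)
      also have "\<dots> = emeasure M (Ev \<inter> {\<omega>\<in>space M. T j \<omega> \<in> D} \<inter> {\<omega>\<in>space M. S j \<omega> \<in> H})"
        by (rule nn_integral_indicator) measurable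
      also have "Ev \<inter> {\<omega>\<in>space M. T j \<omega> \<in> D} \<inter> {\<omega>\<in>space M. S j \<omega> \<in> H} =
          Ev \<inter> {\<omega>. T j \<omega> \<in> D} \<inter> {\<omega>. S j \<omega> \<in> H}"
        by (auto simp: Ev_def)
      finally show ?thesis .
    qed
    have "N' = scale_measure (c * emeasure (sum_law y j) D) (exp_law ?r)"
    proof (rule measure_eqI_lessThan)
      show "sets N' = sets borel" by (simp add: N'_def)
      show "sets (scale_measure (c * emeasure (sum_law y j) D) (exp_law ?r)) = sets borel" by simp
      fix x :: real
      show "emeasure N' {x<..} < \<infinity>"
        by (simp add: N' emeasure_eq_measure)
      \<comment> \<open>The tail event \<open>x < S j\<close>, intersected with
        \<open>0 < S j\<close>, is the event of the induction hypothesis with the threshold at index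
        \<open>j\<close> set to \<open>max x 0\<close>.\<close>
      let ?s = "s(j := max x 0)"
      have prod: "(\<Prod>i=j..<k. exp (- exit_rate E q (y i) * ?s i)) =
          exp (- ?r * max x 0) * (\<Prod>i=Suc j..<k. exp (- exit_rate E q (y i) * s i))"
        using Suc.prems(1) by (subst prod.atLeast_Suc_lessThan) auto
      have "Ev \<inter> {\<omega>. T j \<omega> \<in> D} \<inter> {\<omega>. S j \<omega> \<in> {x<..}} =
        {\<omega> \<in> space M. (\<forall>i\<le>k. Y i \<omega> = y i) \<and> (\<forall>i<j. 0 < S i \<omega>) \<and>
          (\<forall>i<k. j \<le> i \<longrightarrow> ?s i < S i \<omega>) \<and> T j \<omega> \<in> D}"
      proof (rule set_eqI)
        fix \<omega>
        have "(\<forall>i<k. j \<le> i \<longrightarrow> ?s i < S i \<omega>) \<longleftrightarrow> max x 0 < S j \<omega> \<and> (\<forall>i<k. Suc j \<le> i \<longrightarrow> s i < S i \<omega>)"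
        proof (intro iffI conjI allI impI)
          fix i assume "max x 0 < S j \<omega> \<and> (\<forall>i<k. Suc j \<le> i \<longrightarrow> s i < S i \<omega>)" "i < k" "j \<le> i"
          then show "?s i < S i \<omega>" by (cases "i = j") simp_all
        next
          fix i assume *: "\<forall>i<k. j \<le> i \<longrightarrow> ?s i < S i \<omega>" and i: "i < k" "Suc j \<le> i"
          from *[rule_format, of i] i show "s i < S i \<omega>" by simp
        next
          assume *: "\<forall>i<k. j \<le> i \<longrightarrow> ?s i < S i \<omega>"
          from *[rule_format, of j] Suc.prems(1) show "max x 0 < S j \<omega>" by simp
        qed
        then show "(\<omega> \<in> Ev \<inter> {\<omega>. T j \<omega> \<in> D} \<inter> {\<omega>. S j \<omega> \<in> {x<..}}) =
          (\<omega> \<in> {\<omega> \<in> space M. (\<forall>i\<le>k. Y i \<omega> = y i) \<and> (\<forall>i<j. 0 < S i \<omega>) \<and>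
          (\<forall>i<k. j \<le> i \<longrightarrow> ?s i < S i \<omega>) \<and> T j \<omega> \<in> D})"
          unfolding Ev_def by (simp only: mem_Collect_eq Int_iff greaterThan_iff max_less_iff_conj) blast
      qed
      then have "emeasure N' {x<..} = emeasure M {\<omega> \<in> space M. (\<forall>i\<le>k. Y i \<omega> = y i) \<and> (\<forall>i<j. 0 < S i \<omega>) \<and>
          (\<forall>i<k. j \<le> i \<longrightarrow> ?s i < S i \<omega>) \<and> T j \<omega> \<in> D}"
        by (simp add: N')
      also have "\<dots> = ennreal (weight k y * (\<Prod>i=j..<k. exp (- exit_rate E q (y i) * ?s i))) *
          emeasure (sum_law y j) D"
        using Suc.prems by (intro Suc.IH) auto
      also have "\<dots> = c * ennreal (exp (- ?r * max x 0)) * emeasure (sum_law y j) D"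
        unfolding prod c_def using w
        by (subst ennreal_mult[symmetric]) (auto intro!: mult_nonneg_nonneg prod_nonneg simp: mult_ac)
      finally show "emeasure N' {x<..} = emeasure (scale_measure (c * emeasure (sum_law y j) D) (exp_law ?r)) {x<..}"
        by (simp add: emeasure_exp_law_greaterThan[OF r] mult_ac)
    qed
    from arg_cong[OF this, of "\<lambda>N. emeasure N H"] show ?thesis
      by (simp add: N'[OF H])
  qed
  \<comment> \<open>By \<open>half\<close> both measures agree on rectangles. Hence
    \<open>T j\<close> and \<open>S j\<close> are independent on the path event, and their sum has
    the convolution as its law.\<close>
  have "scale_measure c (sum_law y j) \<Otimes>\<^sub>M exp_law ?r = N"
  proof (rule pair_measure_eqI)
    show "sigma_finite_measure (scale_measure c (sum_law y j))"
      by (intro finite_measure.axioms(1) finite_measureI)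
        (simp add: c_def A.emeasure_space_1 space_scale_measure ennreal_mult_eq_top_iff)
    show "sigma_finite_measure (exp_law ?r)" ..
    show "sets (scale_measure c (sum_law y j) \<Otimes>\<^sub>M exp_law ?r) = sets N"
      unfolding N_def by (simp cong: sets_pair_measure_cong)
    fix D H assume "D \<in> sets (scale_measure c (sum_law y j))" "H \<in> sets (exp_law ?r)"
    then have [measurable]: "D \<in> sets borel" "H \<in> sets borel" by auto
    have "emeasure N (D \<times> H) = (\<integral>\<^sup>+\<omega>. indicator Ev \<omega> * indicator ((\<lambda>\<omega>. (T j \<omega>, S j \<omega>)) -` (D \<times> H) \<inter> space M) \<omega> \<partial>M)"
      unfolding N_def by (simp add: emeasure_distr emeasure_density)
    also have "\<dots> = (\<integral>\<^sup>+\<omega>. indicator (Ev \<inter> {\<omega>\<in>space M. T j \<omega> \<in> D} \<inter> {\<omega>\<in>space M. S j \<omega> \<in> H}) \<omega> \<partial>M)"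
      by (intro nn_integral_cong) (auto split: split_indicator)
    also have "\<dots> = emeasure M (Ev \<inter> {\<omega>\<in>space M. T j \<omega> \<in> D} \<inter> {\<omega>\<in>space M. S j \<omega> \<in> H})"
      by (rule nn_integral_indicator) measurable
    also have "Ev \<inter> {\<omega>\<in>space M. T j \<omega> \<in> D} \<inter> {\<omega>\<in>space M. S j \<omega> \<in> H} =
        Ev \<inter> {\<omega>. T j \<omega> \<in> D} \<inter> {\<omega>. S j \<omega> \<in> H}"
      by (auto simp: Ev_def)
    finally show "emeasure (scale_measure c (sum_law y j)) D * emeasure (exp_law ?r) H = emeasure N (D \<times> H)"
      by (simp add: half)
  qed
  note N = this
  have "{\<omega> \<in> space M. (\<forall>i\<le>k. Y i \<omega> = y i) \<and> (\<forall>i<Suc j. 0 < S i \<omega>) \<and>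
        (\<forall>i<k. Suc j \<le> i \<longrightarrow> s i < S i \<omega>) \<and> T (Suc j) \<omega> \<in> A} =
      {\<omega> \<in> space M. \<omega> \<in> Ev \<and> T j \<omega> + S j \<omega> \<in> A}"
    by (auto simp: Ev_def T_def less_Suc_eq)
  then have "emeasure M {\<omega> \<in> space M. (\<forall>i\<le>k. Y i \<omega> = y i) \<and> (\<forall>i<Suc j. 0 < S i \<omega>) \<and>
        (\<forall>i<k. Suc j \<le> i \<longrightarrow> s i < S i \<omega>) \<and> T (Suc j) \<omega> \<in> A} =
      emeasure M {\<omega> \<in> space M. \<omega> \<in> Ev \<and> T j \<omega> + S j \<omega> \<in> A}"
    by simp
  also have "\<dots> = (\<integral>\<^sup>+\<omega>. indicator {\<omega> \<in> space M. \<omega> \<in> Ev \<and> T j \<omega> + S j \<omega> \<in> A} \<omega> \<partial>M)"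
    by (rule nn_integral_indicator[symmetric]) measurable
  also have "\<dots> = (\<integral>\<^sup>+\<omega>. indicator Ev \<omega> * indicator A (T j \<omega> + S j \<omega>) \<partial>M)"
    by (intro nn_integral_cong) (auto split: split_indicator)
  also have "\<dots> = (\<integral>\<^sup>+z. indicator A (fst z + snd z) \<partial>N)"
    unfolding N_def by (simp add: nn_integral_distr nn_integral_density)
  also have "\<dots> = (\<integral>\<^sup>+t. (\<integral>\<^sup>+s. indicator A (t + s) \<partial>exp_law ?r) \<partial>scale_measure c (sum_law y j))"
    unfolding N[symmetric] by (subst B.nn_integral_fst[symmetric]) auto
  also have "\<dots> = c * (\<integral>\<^sup>+t. (\<integral>\<^sup>+s. indicator A (t + s) \<partial>exp_law ?r) \<partial>sum_law y j)"
    by (rule nn_integral_scale_measure) measurable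
  also have "\<dots> = c * (\<integral>\<^sup>+t. indicator A t \<partial>sum_law y (Suc j))"
    using Suc.prems(1) y by (subst nn_integral_sum_law_Suc) auto
  finally show ?case by (simp add: c_def)
qed

text \<open>An event of full measure, but this is only known after
  \<open>AE_holding_time_pos\<close>. Until then positivity has to be carried along, as
  \<open>law\<close> describes the holding times only through the events \<open>s i < S i\<close>
  with \<open>0 \<le> s i\<close>.\<close>

definition good :: "nat \<Rightarrow> 'w set" where "good k = {\<omega> \<in> space M. \<forall>i<k. 0 < S i \<omega>}"

lemma good_measurable[measurable]: "good k \<in> sets M"
  unfolding good_def by measurable

text \<open>The case \<open>j = k\<close> of \<open>emeasure_T_path\<close>, passed from sets to
  functions.\<close>

lemma nn_integral_T_path:
  assumes y: "\<And>i. i \<le> k \<Longrightarrow> y i \<in> E" and f[measurable]: "f \<in> borel_measurable borel"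
  shows "(\<integral>\<^sup>+\<omega>. f (T k \<omega>) * indicator {\<omega>. \<forall>i\<le>k. Y i \<omega> = y i} \<omega> * indicator (good k) \<omega> \<partial>M) =
    ennreal (weight k y) * (\<integral>\<^sup>+t. f t \<partial>sum_law y k)"
proof -
  define Ev where "Ev = {\<omega> \<in> space M. (\<forall>i\<le>k. Y i \<omega> = y i) \<and> (\<forall>i<k. 0 < S i \<omega>)}"
  have [measurable]: "Ev \<in> sets M" unfolding Ev_def by measurable
  have N: "distr (density M (indicator Ev)) borel (T k) = scale_measure (ennreal (weight k y)) (sum_law y k)"
  proof (rule measure_eqI)
    fix A assume "A \<in> sets (distr (density M (indicator Ev)) borel (T k))"
    then have [measurable]: "A \<in> sets borel" by simp
    have "emeasure (distr (density M (indicator Ev)) borel (T k)) A =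
        (\<integral>\<^sup>+\<omega>. indicator Ev \<omega> * indicator (T k -` A \<inter> space M) \<omega> \<partial>M)"
      by (simp add: emeasure_distr emeasure_density)
    also have "\<dots> = (\<integral>\<^sup>+\<omega>. indicator {\<omega> \<in> space M. (\<forall>i\<le>k. Y i \<omega> = y i) \<and> (\<forall>i<k. 0 < S i \<omega>) \<and> T k \<omega> \<in> A} \<omega> \<partial>M)"
      by (intro nn_integral_cong) (auto simp: Ev_def split: split_indicator)
    also have "\<dots> = emeasure M {\<omega> \<in> space M. (\<forall>i\<le>k. Y i \<omega> = y i) \<and> (\<forall>i<k. 0 < S i \<omega>) \<and> T k \<omega> \<in> A}"
      by (rule nn_integral_indicator) measurable
    also have "\<dots> = emeasure M {\<omega> \<in> space M. (\<forall>i\<le>k. Y i \<omega> = y i) \<and> (\<forall>i<k. 0 < S i \<omega>) \<and>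
        (\<forall>i<k. k \<le> i \<longrightarrow> 0 < S i \<omega>) \<and> T k \<omega> \<in> A}"
      by (intro arg_cong[where f="emeasure M"]) auto
    also have "\<dots> = emeasure (scale_measure (ennreal (weight k y)) (sum_law y k)) A"
      using emeasure_T_path[of k y k A "\<lambda>_. 0"] y by simp
    finally show "emeasure (distr (density M (indicator Ev)) borel (T k)) A =
        emeasure (scale_measure (ennreal (weight k y)) (sum_law y k)) A" .
  qed simp
  have "(\<integral>\<^sup>+\<omega>. f (T k \<omega>) * indicator {\<omega>. \<forall>i\<le>k. Y i \<omega> = y i} \<omega> * indicator (good k) \<omega> \<partial>M) =
      (\<integral>\<^sup>+\<omega>. indicator Ev \<omega> * f (T k \<omega>) \<partial>M)"
    by (intro nn_integral_cong) (auto simp: Ev_def good_def split: split_indicator)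
  also have "\<dots> = (\<integral>\<^sup>+t. f t \<partial>distr (density M (indicator Ev)) borel (T k))"
    by (simp add: nn_integral_distr nn_integral_density)
  finally show ?thesis
    unfolding N by (simp add: nn_integral_scale_measure)
qed

section \<open>The Markov property at jump times\<close>

text \<open>The transition operator of the chain of pairs \<open>(T k, Y k)\<close>: from time
  \<open>t\<close> and state \<open>x\<close>, the next state and the holding time are drawn
  independently.\<close>

definition next_mean :: "(real \<Rightarrow> 's \<Rightarrow> ennreal) \<Rightarrow> real \<Rightarrow> 's \<Rightarrow> ennreal" where
  "next_mean h t x =
    (\<integral>\<^sup>+z. ennreal (jump_prob E q x z) * (\<integral>\<^sup>+s. h (t + s) z \<partial>exp_law (exit_rate E q x)) \<partial>count_space E)"

lemma next_mean_measurable: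
  assumes [measurable]: "\<And>z. (\<lambda>t. h t z) \<in> borel_measurable borel" and "x \<in> E"
  shows "(\<lambda>t. next_mean h t x) \<in> borel_measurable borel"
proof -
  interpret B: prob_space "exp_law (exit_rate E q x)"
    using \<open>x \<in> E\<close> by (intro prob_space_exponential_density rate_pos)
  interpret C: sigma_finite_measure "count_space E"
    by (rule sigma_finite_measure_count_space_countable) (rule countableI_type)
  let ?g = "\<lambda>(z, t). ennreal (jump_prob E q x z) * (\<integral>\<^sup>+s. h (t + s) z \<partial>exp_law (exit_rate E q x))"
  have "?g \<in> borel_measurable (count_space E \<Otimes>\<^sub>M borel)"
    by (rule measurable_pair_measure_countable1) (auto intro: countableI_type)
  then have "?g \<circ> (\<lambda>(t, z). (z, t)) \<in> borel_measurable (borel \<Otimes>\<^sub>M count_space E)"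
    by (rule measurable_comp[OF measurable_pair_swap'])
  then show ?thesis
    unfolding next_mean_def
    by (intro C.borel_measurable_nn_integral) (simp add: split_beta' comp_def)
qed

lemma next_mean_measurable':
  assumes [measurable]: "\<And>l z. (\<lambda>t. h l t z) \<in> borel_measurable borel"
  shows "(\<lambda>\<omega>. next_mean (h (hist k \<omega>)) (T k \<omega>) (Y k \<omega>)) \<in> borel_measurable M"
proof (rule measurable_compose_countable'[where g = "Y k" and I = E, OF _ Y_E countableI_type])
  fix x assume "x \<in> E"
  show "(\<lambda>\<omega>. next_mean (h (hist k \<omega>)) (T k \<omega>) x) \<in> borel_measurable M"
  proof (rule measurable_compose_countable[where g = "hist k"])
    fix l
    have [measurable]: "(\<lambda>t. next_mean (h l) t x) \<in> borel_measurable borel"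
      using \<open>x \<in> E\<close> by (intro next_mean_measurable) measurable
    show "(\<lambda>\<omega>. next_mean (h l) (T k \<omega>) x) \<in> borel_measurable M" by measurable
  qed measurable
qed

text \<open>Extending the path \<open>l\<close> by a state \<open>z\<close> multiplies its weight by
  one jump probability and convolves the law of the jump time with one more exponential law. Summing
  over \<open>z\<close> gives \<open>next_mean\<close>.\<close>

lemma markov_step_path:
  assumes h[measurable]: "\<And>z. (\<lambda>t. h t z) \<in> borel_measurable borel"
  shows "(\<integral>\<^sup>+\<omega>. h (T (Suc k) \<omega>) (Y (Suc k) \<omega>) * indicator (good (Suc k)) \<omega> * indicator {\<omega>. hist k \<omega> = l} \<omega> \<partial>M) =
    (\<integral>\<^sup>+\<omega>. next_mean h (T k \<omega>) (Y k \<omega>) * indicator (good k) \<omega> * indicator {\<omega>. hist k \<omega> = l} \<omega> \<partial>M)"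
proof (cases "length l = Suc k \<and> set l \<subseteq> E")
  case False
  \<comment> \<open>Lists of the wrong length or with entries outside \<open>E\<close> are never
    histories, so both sides vanish.\<close>
  then have "hist k \<omega> \<noteq> l" if "\<omega> \<in> space M" for \<omega>
    using Y_in[OF that] by (auto simp: hist_def simp del: upt_Suc)
  then show ?thesis by (auto intro!: nn_integral_cong)
next
  case True
  \<comment> \<open>The path \<open>l\<close>, continued by \<open>z\<close> at index
    \<open>Suc k\<close>.\<close>
  define y where "y z i = (if i = Suc k then z else l ! i)" for z i
  have y: "y z i \<in> E" if "z \<in> E" "i \<le> Suc k" for z i
    using True that by (auto simp: y_def subset_iff)
  have yk: "y z k = l ! k" for z by (simp add: y_def)
  have hist_y: "{\<omega>. hist k \<omega> = l} = {\<omega>. \<forall>i\<le>k. Y i \<omega> = y z i}" for z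
    using True by (auto simp: hist_eq_iff y_def)
  have lk: "l ! k \<in> E" using True by (auto simp: subset_iff)
  interpret B: prob_space "exp_law (exit_rate E q (l ! k))"
    using lk by (intro prob_space_exponential_density rate_pos)
  define g where "g z t = (\<integral>\<^sup>+s. h (t + s) z \<partial>exp_law (exit_rate E q (l ! k)))" for z t
  have g[measurable]: "g z \<in> borel_measurable borel" for z
    unfolding g_def by measurable
  have step: "(\<integral>\<^sup>+\<omega>. h (T (Suc k) \<omega>) z * indicator {\<omega>. \<forall>i\<le>Suc k. Y i \<omega> = y z i} \<omega> * indicator (good (Suc k)) \<omega> \<partial>M) =
      (\<integral>\<^sup>+\<omega>. ennreal (jump_prob E q (l ! k) z) * g z (T k \<omega>) * indicator (good k) \<omega> * indicator {\<omega>. hist k \<omega> = l} \<omega> \<partial>M)"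
    if z: "z \<in> E" for z
  proof -
    have "(\<integral>\<^sup>+\<omega>. h (T (Suc k) \<omega>) z * indicator {\<omega>. \<forall>i\<le>Suc k. Y i \<omega> = y z i} \<omega> * indicator (good (Suc k)) \<omega> \<partial>M) =
        ennreal (weight (Suc k) (y z)) * (\<integral>\<^sup>+t. h t z \<partial>sum_law (y z) (Suc k))"
      using y[OF z] by (intro nn_integral_T_path) auto
    also have "weight (Suc k) (y z) = jump_prob E q (l ! k) z * weight k (y z)"
      by (simp add: weight_def y_def)
    also have "(\<integral>\<^sup>+t. h t z \<partial>sum_law (y z) (Suc k)) = (\<integral>\<^sup>+t. g z t \<partial>sum_law (y z) k)"
      using y[OF z] by (subst nn_integral_sum_law_Suc) (auto simp: g_def[abs_def] yk)
    also have "ennreal (jump_prob E q (l ! k) z * weight k (y z)) * (\<integral>\<^sup>+t. g z t \<partial>sum_law (y z) k) =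
        ennreal (jump_prob E q (l ! k) z) * (ennreal (weight k (y z)) * (\<integral>\<^sup>+t. g z t \<partial>sum_law (y z) k))"
      using y[OF z] by (subst ennreal_mult) (auto intro: weight_nonneg jump_nonneg lk z simp: mult.assoc)
    also have "ennreal (weight k (y z)) * (\<integral>\<^sup>+t. g z t \<partial>sum_law (y z) k) =
        (\<integral>\<^sup>+\<omega>. g z (T k \<omega>) * indicator {\<omega>. \<forall>i\<le>k. Y i \<omega> = y z i} \<omega> * indicator (good k) \<omega> \<partial>M)"
      using y[OF z] by (intro nn_integral_T_path[symmetric]) auto
    also have "\<dots> = (\<integral>\<^sup>+\<omega>. g z (T k \<omega>) * indicator (good k) \<omega> * indicator {\<omega>. hist k \<omega> = l} \<omega> \<partial>M)"
      unfolding hist_y[of z] by (simp add: mult_ac)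
    also have "ennreal (jump_prob E q (l ! k) z) * \<dots> =
      (\<integral>\<^sup>+\<omega>. ennreal (jump_prob E q (l ! k) z) * (g z (T k \<omega>) * indicator (good k) \<omega> * indicator {\<omega>. hist k \<omega> = l} \<omega>) \<partial>M)"
      by (rule nn_integral_cmult[symmetric]) measurable
    finally show ?thesis by (simp add: mult_ac)
  qed
  have "(\<integral>\<^sup>+\<omega>. h (T (Suc k) \<omega>) (Y (Suc k) \<omega>) * indicator (good (Suc k)) \<omega> * indicator {\<omega>. hist k \<omega> = l} \<omega> \<partial>M) =
    (\<integral>\<^sup>+\<omega>. (\<integral>\<^sup>+z. h (T (Suc k) \<omega>) z * indicator {\<omega>. \<forall>i\<le>Suc k. Y i \<omega> = y z i} \<omega> * indicator (good (Suc k)) \<omega> \<partial>count_space E) \<partial>M)"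
  proof (rule nn_integral_cong)
    fix \<omega> assume \<omega>: "\<omega> \<in> space M"
    have ind: "indicator {\<omega>. \<forall>i\<le>Suc k. Y i \<omega> = y z i} \<omega> =
        (indicator {Y (Suc k) \<omega>} z * indicator {\<omega>. hist k \<omega> = l} \<omega> :: ennreal)" for z
      unfolding hist_y[of z] by (auto simp: le_Suc_eq y_def split: split_indicator)
    have "(\<integral>\<^sup>+z. h (T (Suc k) \<omega>) z * indicator {\<omega>. \<forall>i\<le>Suc k. Y i \<omega> = y z i} \<omega> * indicator (good (Suc k)) \<omega> \<partial>count_space E) =
      (\<integral>\<^sup>+z. (h (T (Suc k) \<omega>) z * indicator {\<omega>. hist k \<omega> = l} \<omega> * indicator (good (Suc k)) \<omega>) * indicator {Y (Suc k) \<omega>} z \<partial>count_space E)"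
      unfolding ind by (simp add: mult_ac)
    also have "\<dots> = h (T (Suc k) \<omega>) (Y (Suc k) \<omega>) * indicator {\<omega>. hist k \<omega> = l} \<omega> * indicator (good (Suc k)) \<omega>"
      using Y_in[OF \<omega>] by (subst nn_integral_indicator_singleton) auto
    finally show "h (T (Suc k) \<omega>) (Y (Suc k) \<omega>) * indicator (good (Suc k)) \<omega> * indicator {\<omega>. hist k \<omega> = l} \<omega> =
      (\<integral>\<^sup>+z. h (T (Suc k) \<omega>) z * indicator {\<omega>. \<forall>i\<le>Suc k. Y i \<omega> = y z i} \<omega> * indicator (good (Suc k)) \<omega> \<partial>count_space E)"
      by (simp add: mult_ac)
  qed
  also have "\<dots> = (\<integral>\<^sup>+z. (\<integral>\<^sup>+\<omega>. h (T (Suc k) \<omega>) z * indicator {\<omega>. \<forall>i\<le>Suc k. Y i \<omega> = y z i} \<omega> * indicator (good (Suc k)) \<omega> \<partial>M) \<partial>count_space E)"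
    by (rule nn_integral_count_space_nn_integral) (auto intro: countableI_type)
  also have "\<dots> = (\<integral>\<^sup>+z. (\<integral>\<^sup>+\<omega>. ennreal (jump_prob E q (l ! k) z) * g z (T k \<omega>) * indicator (good k) \<omega> * indicator {\<omega>. hist k \<omega> = l} \<omega> \<partial>M) \<partial>count_space E)"
    by (intro nn_integral_cong step) simp
  also have "\<dots> = (\<integral>\<^sup>+\<omega>. (\<integral>\<^sup>+z. ennreal (jump_prob E q (l ! k) z) * g z (T k \<omega>) * indicator (good k) \<omega> * indicator {\<omega>. hist k \<omega> = l} \<omega> \<partial>count_space E) \<partial>M)"
    by (rule nn_integral_count_space_nn_integral[symmetric]) (auto intro: countableI_type)
  also have "\<dots> = (\<integral>\<^sup>+\<omega>. next_mean h (T k \<omega>) (Y k \<omega>) * indicator (good k) \<omega> * indicator {\<omega>. hist k \<omega> = l} \<omega> \<partial>M)"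
  proof (rule nn_integral_cong)
    fix \<omega>
    have "Y k \<omega> = l ! k" if "hist k \<omega> = l" using that by (auto simp: hist_eq_iff)
    then show "(\<integral>\<^sup>+z. ennreal (jump_prob E q (l ! k) z) * g z (T k \<omega>) * indicator (good k) \<omega> * indicator {\<omega>. hist k \<omega> = l} \<omega> \<partial>count_space E) =
      next_mean h (T k \<omega>) (Y k \<omega>) * indicator (good k) \<omega> * indicator {\<omega>. hist k \<omega> = l} \<omega>"
      by (simp add: next_mean_def g_def split: split_indicator)
  qed
  finally show ?thesis .
qed

text \<open>The atoms \<open>hist k = l\<close> are summed up. Since \<open>h\<close> may depend on
  the history, indicators of past events can be carried through a step.\<close>

lemma markov_step_good:
  assumes h[measurable]: "\<And>l z. (\<lambda>t. h l t z) \<in> borel_measurable borel"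
  shows "(\<integral>\<^sup>+\<omega>. h (hist k \<omega>) (T (Suc k) \<omega>) (Y (Suc k) \<omega>) * indicator (good (Suc k)) \<omega> \<partial>M) =
    (\<integral>\<^sup>+\<omega>. next_mean (h (hist k \<omega>)) (T k \<omega>) (Y k \<omega>) * indicator (good k) \<omega> \<partial>M)"
proof (rule nn_integral_eqI_countable[where X = "hist k"])
  have "(\<lambda>\<omega>. h l (T (Suc k) \<omega>) (Y (Suc k) \<omega>)) \<in> borel_measurable M" for l
    by (rule measurable_compose_countable[where g = "Y (Suc k)"]) measurable
  then have [measurable]: "(\<lambda>\<omega>. h (hist k \<omega>) (T (Suc k) \<omega>) (Y (Suc k) \<omega>)) \<in> borel_measurable M"
    by (rule measurable_compose_countable[where g = "hist k"]) measurable
  show "(\<lambda>\<omega>. h (hist k \<omega>) (T (Suc k) \<omega>) (Y (Suc k) \<omega>) * indicator (good (Suc k)) \<omega>) \<in> borel_measurable M"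
    by measurable
  have [measurable]: "(\<lambda>\<omega>. next_mean (h (hist k \<omega>)) (T k \<omega>) (Y k \<omega>)) \<in> borel_measurable M"
    by (rule next_mean_measurable'[OF h])
  show "(\<lambda>\<omega>. next_mean (h (hist k \<omega>)) (T k \<omega>) (Y k \<omega>) * indicator (good k) \<omega>) \<in> borel_measurable M"
    by measurable
  fix l
  have "(\<integral>\<^sup>+\<omega>. h (hist k \<omega>) (T (Suc k) \<omega>) (Y (Suc k) \<omega>) * indicator (good (Suc k)) \<omega> * indicator {\<omega>. hist k \<omega> = l} \<omega> \<partial>M) =
     (\<integral>\<^sup>+\<omega>. h l (T (Suc k) \<omega>) (Y (Suc k) \<omega>) * indicator (good (Suc k)) \<omega> * indicator {\<omega>. hist k \<omega> = l} \<omega> \<partial>M)"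
    by (intro nn_integral_cong) (auto split: split_indicator)
  also have "\<dots> = (\<integral>\<^sup>+\<omega>. next_mean (h l) (T k \<omega>) (Y k \<omega>) * indicator (good k) \<omega> * indicator {\<omega>. hist k \<omega> = l} \<omega> \<partial>M)"
    by (rule markov_step_path[OF h])
  also have "\<dots> = (\<integral>\<^sup>+\<omega>. next_mean (h (hist k \<omega>)) (T k \<omega>) (Y k \<omega>) * indicator (good k) \<omega> * indicator {\<omega>. hist k \<omega> = l} \<omega> \<partial>M)"
    by (intro nn_integral_cong) (auto split: split_indicator)
  finally show "(\<integral>\<^sup>+\<omega>. h (hist k \<omega>) (T (Suc k) \<omega>) (Y (Suc k) \<omega>) * indicator (good (Suc k)) \<omega> * indicator {\<omega>. hist k \<omega> = l} \<omega> \<partial>M) =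
    (\<integral>\<^sup>+\<omega>. next_mean (h (hist k \<omega>)) (T k \<omega>) (Y k \<omega>) * indicator (good k) \<omega> * indicator {\<omega>. hist k \<omega> = l} \<omega> \<partial>M)" .
qed measurable

lemma next_mean_const:
  assumes "x \<in> E"
  shows "next_mean (\<lambda>_ _. c) t x = c"
proof -
  interpret B: prob_space "exp_law (exit_rate E q x)"
    using assms by (intro prob_space_exponential_density rate_pos)
  have "next_mean (\<lambda>_ _. c) t x = (\<integral>\<^sup>+z. ennreal (jump_prob E q x z) * c \<partial>count_space E)"
    unfolding next_mean_def using B.emeasure_space_1 by simp
  also have "\<dots> = c"
    by (subst nn_integral_multc) (auto simp: jump_total[OF assms])
  finally show ?thesis .
qed

text \<open>One Markov step applied to the constant 1 shows that no mass is lost between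
  \<open>good k\<close> and \<open>good (Suc k)\<close>.\<close>

lemma AE_holding_time_pos: "AE \<omega> in M. \<forall>k. 0 < S k \<omega>"
proof -
  have "emeasure M (good k) = 1" for k
  proof (induction k)
    case 0
    then show ?case by (simp add: good_def emeasure_space_1)
  next
    case (Suc k)
    have "emeasure M (good (Suc k)) = (\<integral>\<^sup>+\<omega>. 1 * indicator (good (Suc k)) \<omega> \<partial>M)"
      by simp
    also have "\<dots> = (\<integral>\<^sup>+\<omega>. next_mean (\<lambda>_ _. 1) (T k \<omega>) (Y k \<omega>) * indicator (good k) \<omega> \<partial>M)"
      using markov_step_good[of "\<lambda>_ _ _. 1" k] by simp
    also have "\<dots> = (\<integral>\<^sup>+\<omega>. 1 * indicator (good k) \<omega> \<partial>M)"
      by (intro nn_integral_cong) (auto simp: next_mean_const Y_in)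
    finally show ?case using Suc by simp
  qed
  then have "AE \<omega> in M. \<omega> \<in> good k" for k
    by (intro AE_in_set_eq_1[THEN iffD2]) (auto simp: measure_def)
  then have "AE \<omega> in M. \<forall>k. \<omega> \<in> good k"
    by (simp add: AE_all_countable)
  then show ?thesis
    by (rule AE_mp) (auto simp: good_def intro!: AE_I2)
qed

lemma markov_step:
  assumes h: "\<And>l z. (\<lambda>t. h l t z) \<in> borel_measurable borel"
  shows "(\<integral>\<^sup>+\<omega>. h (hist k \<omega>) (T (Suc k) \<omega>) (Y (Suc k) \<omega>) \<partial>M) =
    (\<integral>\<^sup>+\<omega>. next_mean (h (hist k \<omega>)) (T k \<omega>) (Y k \<omega>) \<partial>M)"
proof -
  have *: "(\<integral>\<^sup>+\<omega>. f \<omega> * indicator (good k) \<omega> \<partial>M) = (\<integral>\<^sup>+\<omega>. f \<omega> \<partial>M)" for f k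
    using AE_holding_time_pos AE_space
    by (intro nn_integral_cong_AE) (auto simp: good_def elim!: eventually_elim2)
  show ?thesis using markov_step_good[OF h, where k = k] unfolding * .
qed

text \<open>The indicator of a jump of probability zero has \<open>next_mean\<close> zero: in each
  term either the jump probability or the indicator vanishes.\<close>

lemma AE_jump_pos: "AE \<omega> in M. \<forall>k. jump_prob E q (Y k \<omega>) (Y (Suc k) \<omega>) \<noteq> 0"
  unfolding AE_all_countable
proof
  fix k
  define h :: "'s list \<Rightarrow> real \<Rightarrow> 's \<Rightarrow> ennreal"
    where "h l t z = (if jump_prob E q (last l) z = 0 then 1 else 0)" for l t z
  have last: "last (hist k \<omega>) = Y k \<omega>" for \<omega> by (simp add: hist_def)
  have "(\<integral>\<^sup>+\<omega>. h (hist k \<omega>) (T (Suc k) \<omega>) (Y (Suc k) \<omega>) \<partial>M) =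
      (\<integral>\<^sup>+\<omega>. next_mean (h (hist k \<omega>)) (T k \<omega>) (Y k \<omega>) \<partial>M)"
    by (rule markov_step) (simp add: h_def)
  also have "\<dots> = (\<integral>\<^sup>+\<omega>. 0 \<partial>M)"
  proof (intro nn_integral_cong)
    fix \<omega>
    have "ennreal (jump_prob E q (Y k \<omega>) z) * (\<integral>\<^sup>+s. h (hist k \<omega>) (T k \<omega> + s) z \<partial>exp_law (exit_rate E q (Y k \<omega>))) = 0" for z
      by (simp add: h_def last)
    then show "next_mean (h (hist k \<omega>)) (T k \<omega>) (Y k \<omega>) = 0"
      unfolding next_mean_def by (simp only:) simp
  qed
  finally have "(\<integral>\<^sup>+\<omega>. h (hist k \<omega>) (T (Suc k) \<omega>) (Y (Suc k) \<omega>) \<partial>M) = 0" by simp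
  moreover have "(\<lambda>\<omega>. h (hist k \<omega>) (T (Suc k) \<omega>) (Y (Suc k) \<omega>)) \<in> borel_measurable M"
  proof (rule measurable_compose_countable[where g = "\<lambda>\<omega>. Y (Suc k) \<omega>"])
    fix z show "(\<lambda>\<omega>. h (hist k \<omega>) (T (Suc k) \<omega>) z) \<in> borel_measurable M"
      by (rule measurable_compose_countable[where g = "hist k"]) (auto simp: h_def)
  qed measurable
  ultimately have "AE \<omega> in M. h (hist k \<omega>) (T (Suc k) \<omega>) (Y (Suc k) \<omega>) = 0"
    by (simp add: nn_integral_0_iff_AE)
  then show "AE \<omega> in M. jump_prob E q (Y k \<omega>) (Y (Suc k) \<omega>) \<noteq> 0"
    by (rule AE_mp) (auto simp: h_def last intro!: AE_I2)
qed

lemma AE_start: "AE \<omega> in M. Y 0 \<omega> = x0"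
proof -
  have "prob {\<omega> \<in> space M. Y 0 \<omega> = x0} = 1"
    using law[of 0 "\<lambda>_. x0" "\<lambda>_. 0"] x0_E by simp
  then show ?thesis
    by (subst (asm) prob_Collect_eq_1) auto
qed

end

section \<open>The barrier\<close>

text \<open>The hypothesis \<open>le\<close> bounds \<open>exp (- r * s) * g s\<close> by the
  derivative of \<open>- exp (- r * s) * f s\<close>, which is then integrated. With
  \<open>r\<close> the exit rate, \<open>f\<close> a barrier in a frozen state and \<open>g\<close>
  its rate-weighted sum over the neighbours, an infinitesimal drift bound becomes a bound over one
  holding time.\<close>

lemma nn_integral_exp_le_Icc:
  fixes f f' g :: "real \<Rightarrow> real"
  assumes [measurable]: "f \<in> borel_measurable borel" "f' \<in> borel_measurable borel"
    and "a \<le> b" and f: "\<And>s. a \<le> s \<Longrightarrow> s \<le> b \<Longrightarrow> (f has_real_derivative f' s) (at s)"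
    and g: "\<And>s. a \<le> s \<Longrightarrow> s \<le> b \<Longrightarrow> 0 \<le> g s"
    and le: "\<And>s. a \<le> s \<Longrightarrow> s \<le> b \<Longrightarrow> f' s + g s \<le> r * f s"
    and "0 \<le> f b"
  shows "(\<integral>\<^sup>+s. ennreal (exp (- r * s) * g s) * indicator {a..b} s \<partial>lborel) + ennreal (exp (- r * b) * f b) \<le>
    ennreal (exp (- r * a) * f a)"
proof -
  let ?F = "\<lambda>s. - (exp (- r * s) * f s)" and ?d = "\<lambda>s. exp (- r * s) * (r * f s - f' s)"
  have d: "exp (- r * s) * g s \<le> ?d s" if "a \<le> s" "s \<le> b" for s
    using le[OF that] by (intro mult_left_mono) auto
  have deriv: "(?F has_real_derivative ?d s) (at s)" if "a \<le> s" "s \<le> b" for s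
    using that by (auto intro!: derivative_eq_intros f simp: algebra_simps)
  have nonneg: "0 \<le> ?d s" if "a \<le> s" "s \<le> b" for s
    using d[OF that] g[OF that] by (auto intro: order_trans[rotated])
  have "(\<integral>\<^sup>+s. ennreal (exp (- r * s) * g s) * indicator {a..b} s \<partial>lborel) \<le>
      (\<integral>\<^sup>+s. ennreal (?d s) * indicator {a..b} s \<partial>lborel)"
    using d by (intro nn_integral_mono) (auto split: split_indicator intro!: ennreal_leI)
  also have "\<dots> = ennreal (?F b - ?F a)"
    using \<open>a \<le> b\<close> deriv nonneg by (intro nn_integral_FTC_Icc) auto
  finally have "(\<integral>\<^sup>+s. ennreal (exp (- r * s) * g s) * indicator {a..b} s \<partial>lborel) + ennreal (exp (- r * b) * f b)
      \<le> ennreal (?F b - ?F a) + ennreal (exp (- r * b) * f b)"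
    by (rule add_right_mono)
  also have "\<dots> = ennreal (exp (- r * a) * f a)"
  proof -
    have "?F a \<le> ?F b"
      using \<open>a \<le> b\<close> deriv nonneg by (intro DERIV_nonneg_imp_nondecreasing[of a b ?F]) blast+
    then show ?thesis
      using \<open>0 \<le> f b\<close> by (subst ennreal_plus[symmetric]) auto
  qed
  finally show ?thesis .
qed

text \<open>The same on a half-line, where the limit hypothesis replaces the boundary term at
  \<open>b\<close>.\<close>

lemma nn_integral_exp_le_atLeast:
  fixes f f' g :: "real \<Rightarrow> real"
  assumes [measurable]: "f \<in> borel_measurable borel" "f' \<in> borel_measurable borel"
    and f: "\<And>s. a \<le> s \<Longrightarrow> (f has_real_derivative f' s) (at s)"
    and g: "\<And>s. a \<le> s \<Longrightarrow> 0 \<le> g s"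
    and le: "\<And>s. a \<le> s \<Longrightarrow> f' s + g s \<le> r * f s"
    and lim: "((\<lambda>s. exp (- r * s) * f s) \<longlongrightarrow> 0) at_top"
  shows "(\<integral>\<^sup>+s. ennreal (exp (- r * s) * g s) * indicator {a..} s \<partial>lborel) \<le>
    ennreal (exp (- r * a) * f a)"
proof -
  let ?F = "\<lambda>s. - (exp (- r * s) * f s)" and ?d = "\<lambda>s. exp (- r * s) * (r * f s - f' s)"
  have d: "exp (- r * s) * g s \<le> ?d s" if "a \<le> s" for s
    using le[OF that] by (intro mult_left_mono) auto
  have "(\<integral>\<^sup>+s. ennreal (exp (- r * s) * g s) * indicator {a..} s \<partial>lborel) \<le>
      (\<integral>\<^sup>+s. ennreal (?d s) * indicator {a..} s \<partial>lborel)"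
    using d by (intro nn_integral_mono) (auto split: split_indicator intro!: ennreal_leI)
  also have "\<dots> = ennreal (0 - ?F a)"
  proof (rule nn_integral_FTC_atLeast)
    fix s assume s: "a \<le> s"
    then show "(?F has_real_derivative ?d s) (at s)"
      by (auto intro!: derivative_eq_intros f simp: algebra_simps)
    show "0 \<le> ?d s" using d[of s] g[of s] s by (auto intro: order_trans[rotated])
  qed (use tendsto_minus[OF lim] in auto)
  finally show ?thesis by simp
qed

text \<open>The quadratic part of \<open>early\<close> is the squared distance of \<open>(a + i b) exp (- i t)\<close> from \<open>n\<close>. As
  \<open>(A + i B) exp (- i t)\<close> is a martingale, its drift is \<open>a + b\<close>, which the exponential term absorbs up to
  time \<open>pi\<close>. The factor 400 makes \<open>early\<close> dominate \<open>late\<close> at time \<open>pi\<close>.\<close>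

definition early :: "real \<Rightarrow> real \<Rightarrow> real \<Rightarrow> real \<Rightarrow> real" where
  "early n t a b = 400 / n\<^sup>2 *
     (a\<^sup>2 + b\<^sup>2 - 2 * n * (a * cos t + b * sin t) + n\<^sup>2 + exp (2 * (pi - t)) * (a + b))"

definition angle :: "real \<Rightarrow> real \<Rightarrow> real" where
  "angle a b = 12 * a / (a + b + 1)"

text \<open>\<open>angle\<close> is at most 12 and has drift at most \<open>- 1\<close>, so that \<open>late\<close> has nonpositive drift.\<close>

definition late :: "real \<Rightarrow> real \<Rightarrow> real \<Rightarrow> real" where
  "late t a b = t\<^sup>2 + 2 * t * angle a b + 24 * angle a b"

text \<open>At time \<open>pi\<close> the value can only drop, by \<open>early_pi_ge_late\<close>; a
  downward jump preserves the supermartingale inequality.\<close>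

definition barrier :: "real \<Rightarrow> real \<Rightarrow> real \<Rightarrow> real \<Rightarrow> real" where
  "barrier n t a b = (if t < pi then early n t a b else late t a b)"

section \<open>Sign and drift of the barrier functions\<close>

lemma angle_nonneg: "0 \<le> a \<Longrightarrow> 0 \<le> b \<Longrightarrow> 0 \<le> angle a b"
  by (simp add: angle_def)

lemma angle_le: "0 \<le> a \<Longrightarrow> 0 \<le> b \<Longrightarrow> angle a b \<le> 12"
  by (simp add: angle_def field_simps)

text \<open>With \<open>s = a + b\<close>, the exact drift is at most
  \<open>- 12 * (a\<^sup>2 + b\<^sup>2) / ((s + 1) * (s + 2))\<close>. Here
  \<open>s\<^sup>2 \<le> 2 * (a\<^sup>2 + b\<^sup>2)\<close>, and
  \<open>(s + 1) * (s + 2) \<le> 6 * s\<^sup>2\<close> because \<open>1 \<le> s\<close>; this is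
  where the 12 in \<open>angle\<close> comes from.\<close>

lemma angle_drift:
  assumes "1 \<le> a" "0 \<le> b"
  shows "b * (angle (a - 1) b - angle a b) + a * (angle a (b + 1) - angle a b) \<le> - 1"
proof -
  define s where "s = a + b"
  have s: "1 \<le> s" using assms by (simp add: s_def)
  have "b * (angle (a - 1) b - angle a b) + a * (angle a (b + 1) - angle a b) =
      - 12 * (b * (b + 1) / (s * (s + 1)) + a\<^sup>2 / ((s + 1) * (s + 2)))"
  proof -
    have 1: "b * (angle (a - 1) b - angle a b) = - 12 * (b * (b + 1) / (s * (s + 1)))"
    proof -
      have "angle (a - 1) b - angle a b = 12 * (a - 1) / s - 12 * a / (s + 1)"
        by (simp add: angle_def s_def)
      also have "\<dots> = - 12 * ((b + 1) / (s * (s + 1)))"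
        using s by (simp add: divide_simps) (simp add: s_def algebra_simps)
      finally show ?thesis by (simp only: mult_ac times_divide_eq_right)
    qed
    have 2: "a * (angle a (b + 1) - angle a b) = - 12 * (a\<^sup>2 / ((s + 1) * (s + 2)))"
    proof -
      have "angle a (b + 1) - angle a b = 12 * a / (s + 2) - 12 * a / (s + 1)"
        by (simp add: angle_def s_def add_ac)
      also have "\<dots> = - 12 * (a / ((s + 1) * (s + 2)))"
        using s by (simp add: divide_simps) (simp add: algebra_simps)
      finally show ?thesis by (simp only: mult_ac times_divide_eq_right power2_eq_square)
    qed
    show ?thesis unfolding 1 2 by (simp add: algebra_simps)
  qed
  moreover have "1 / 12 \<le> b * (b + 1) / (s * (s + 1)) + a\<^sup>2 / ((s + 1) * (s + 2))"
  proof -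
    have "(a\<^sup>2 + b\<^sup>2) / ((s + 1) * (s + 2)) \<ge> 1 / 12"
    proof -
      have "s\<^sup>2 \<le> 2 * (a\<^sup>2 + b\<^sup>2)"
        using sum_squares_ge_zero[of "a - b" 0] by (simp add: s_def power2_eq_square algebra_simps)
      moreover have "s\<^sup>2 \<ge> s" using s by (simp add: power2_eq_square)
      ultimately have "(s + 1) * (s + 2) \<le> 12 * (a\<^sup>2 + b\<^sup>2)"
        using s unfolding ring_distribs by (simp add: power2_eq_square[symmetric])
      then show ?thesis using s by (subst pos_le_divide_eq) auto
    qed
    moreover have "b\<^sup>2 / ((s + 1) * (s + 2)) \<le> b * (b + 1) / (s * (s + 1))"
      using s assms by (intro frac_le) (auto simp: power2_eq_square algebra_simps intro!: add_pos_pos)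
    ultimately show ?thesis unfolding add_divide_distrib by linarith
  qed
  then have "- 12 * (b * (b + 1) / (s * (s + 1)) + a\<^sup>2 / ((s + 1) * (s + 2))) \<le> - 12 * (1 / 12)"
    by (rule mult_left_mono_neg) simp
  ultimately show ?thesis by (simp only:)
qed

lemma early_nonneg:
  assumes "0 \<le> a" "0 \<le> b"
  shows "0 \<le> early n t a b"
proof -
  \<comment> \<open>The two squares belong to the real and the imaginary part of
    \<open>(a + i b) exp (- i t) - n\<close>.\<close>
  have "a\<^sup>2 + b\<^sup>2 - 2 * n * (a * cos t + b * sin t) + n\<^sup>2 =
      (a * cos t + b * sin t - n)\<^sup>2 + (b * cos t - a * sin t)\<^sup>2"
  proof -
    have "(a * cos t + b * sin t - n)\<^sup>2 + (b * cos t - a * sin t)\<^sup>2 =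
      (a\<^sup>2 + b\<^sup>2) * ((sin t)\<^sup>2 + (cos t)\<^sup>2) - 2 * n * (a * cos t + b * sin t) + n\<^sup>2"
      unfolding power2_eq_square by algebra
    then show ?thesis by (simp only: sin_cos_squared_add mult_1_right)
  qed
  then have "0 \<le> a\<^sup>2 + b\<^sup>2 - 2 * n * (a * cos t + b * sin t) + n\<^sup>2" by simp
  moreover have "0 \<le> exp (2 * (pi - t)) * (a + b)" using assms by simp
  ultimately show ?thesis
    unfolding early_def by (intro mult_nonneg_nonneg) auto
qed

lemma late_nonneg: "0 \<le> t \<Longrightarrow> 0 \<le> a \<Longrightarrow> 0 \<le> b \<Longrightarrow> 0 \<le> late t a b"
  by (simp add: late_def angle_nonneg)

lemma barrier_nonneg: "0 \<le> a \<Longrightarrow> 0 \<le> b \<Longrightarrow> 0 \<le> barrier n t a b"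
  using order.trans[OF pi_ge_zero, of t] by (auto simp: barrier_def intro!: early_nonneg late_nonneg)

text \<open>At time \<open>pi\<close> the trigonometric term becomes \<open>2 * n * a\<close>, which
  is nonnegative, so \<open>early\<close> is at least 400. On the other side \<open>angle\<close> is
  at most 12, which keeps \<open>late\<close> below 374.\<close>

lemma early_pi_ge_late:
  assumes "0 < n" "0 \<le> a" "0 \<le> b"
  shows "late pi a b \<le> early n pi a b"
proof -
  have "late pi a b \<le> (3.15)\<^sup>2 + 2 * 3.15 * 12 + 24 * 12"
    unfolding late_def using angle_le[OF assms(2,3)] angle_nonneg[OF assms(2,3)] pi_approx
    by (intro add_mono mult_mono power_mono) auto
  also have "\<dots> \<le> 400" by (simp add: power2_eq_square)
  also have "400 = 400 / n\<^sup>2 * n\<^sup>2" using assms by simp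
  also have "\<dots> \<le> early n pi a b"
    unfolding early_def using assms by (intro mult_left_mono) auto
  finally show ?thesis .
qed

definition early' :: "real \<Rightarrow> real \<Rightarrow> real \<Rightarrow> real \<Rightarrow> real" where
  "early' n t a b = 400 / n\<^sup>2 *
     (- 2 * n * (b * cos t - a * sin t) - 2 * exp (2 * (pi - t)) * (a + b))"

lemma early_deriv: "((\<lambda>t. early n t a b) has_real_derivative early' n t a b) (at t)"
  unfolding early_def early'_def by (rule DERIV_cmult) (auto intro!: derivative_eq_intros simp: algebra_simps)

text \<open>The terms linear in \<open>n\<close> cancel, as the rotated process is a martingale, and
  the squares contribute \<open>a + b\<close>. With \<open>e = exp (2 * (pi - t))\<close>, the last
  term contributes \<open>- 2 * e * (a + b)\<close> by its time derivative and
  \<open>e * (a - b)\<close> by the jumps. The total is nonpositive because \<open>e\<close> is at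
  least 1 up to time \<open>pi\<close>.\<close>

lemma early_drift:
  assumes "1 \<le> a" "0 \<le> b" "t \<le> pi"
  shows "early' n t a b + (b * early n t (a - 1) b + a * early n t a (b + 1)) \<le> (a + b) * early n t a b"
proof -
  let ?e = "exp (2 * (pi - t))"
  have "early' n t a b + (b * early n t (a - 1) b + a * early n t a (b + 1)) - (a + b) * early n t a b =
      400 / n\<^sup>2 * (a + b - ?e * (a + b) - 2 * ?e * b)"
    unfolding early_def early'_def by algebra
  also have "\<dots> \<le> 0"
  proof -
    define e where "e = ?e"
    have "1 \<le> e" using assms by (simp add: e_def)
    then have "1 * (a + b) \<le> e * (a + b)" "0 \<le> e * b" using assms by (auto intro!: mult_right_mono)
    then have "a + b - ?e * (a + b) - 2 * ?e * b \<le> 0"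
      unfolding e_def[symmetric] by (simp add: algebra_simps)
    then show ?thesis by (intro mult_nonneg_nonpos) auto
  qed
  finally show ?thesis by simp
qed

text \<open>The coefficient of \<open>angle\<close> in \<open>late\<close> is
  \<open>2 * t + 24\<close>. By \<open>angle_drift\<close> the jumps therefore lower
  \<open>late\<close> at rate at least \<open>2 * t + 24\<close>, which covers the time derivative
  \<open>2 * t + 2 * angle a b\<close> since \<open>angle\<close> is at most 12.\<close>

lemma late_drift:
  assumes "1 \<le> a" "0 \<le> b" "0 \<le> t"
  shows "2 * t + 2 * angle a b + (b * late t (a - 1) b + a * late t a (b + 1)) \<le> (a + b) * late t a b"
proof -
  let ?L = "b * (angle (a - 1) b - angle a b) + a * (angle a (b + 1) - angle a b)"
  have "2 * t + 2 * angle a b + (b * late t (a - 1) b + a * late t a (b + 1)) - (a + b) * late t a b =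
      2 * t + 2 * angle a b + (2 * t + 24) * ?L"
    unfolding late_def by (simp add: algebra_simps)
  also have "\<dots> \<le> 2 * t + 2 * angle a b + (2 * t + 24) * (- 1)"
    using assms by (intro add_left_mono mult_left_mono angle_drift) auto
  also have "\<dots> \<le> 0" using angle_le[of a b] assms by simp
  finally show ?thesis by simp
qed

lemma early_measurable[measurable]: "(\<lambda>t. early n t a b) \<in> borel_measurable borel"
  unfolding early_def by measurable

lemma late_measurable[measurable]: "(\<lambda>t. late t a b) \<in> borel_measurable borel"
  unfolding late_def by measurable

lemma barrier_measurable[measurable]: "(\<lambda>t. barrier n t a b) \<in> borel_measurable borel"
  unfolding barrier_def by measurable

section \<open>The barrier over one holding time\<close>

text \<open>The offset \<open>u\<close> lets one statement serve twice: with \<open>u = 0\<close>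
  for a holding time that begins after \<open>pi\<close>, and with \<open>u = pi - t\<close> for the
  remainder of one that begins earlier.\<close>

lemma barrier_decay_late:
  assumes "1 \<le> a" "0 \<le> b" "0 \<le> t" "pi \<le> t + u" "0 \<le> u"
  shows "(\<integral>\<^sup>+s. ennreal (exp (- (a + b) * s) * (b * late (t + s) (a - 1) b + a * late (t + s) a (b + 1)))
      * indicator {u..} s \<partial>lborel) \<le> ennreal (exp (- (a + b) * u) * late (t + u) a b)"
proof (rule nn_integral_exp_le_atLeast[where f' = "\<lambda>s. 2 * (t + s) + 2 * angle a b"])
  fix s assume s: "u \<le> s"
  show "((\<lambda>s. late (t + s) a b) has_real_derivative 2 * (t + s) + 2 * angle a b) (at s)"
    unfolding late_def by (auto intro!: derivative_eq_intros)
  show "0 \<le> b * late (t + s) (a - 1) b + a * late (t + s) a (b + 1)"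
    using assms s by (auto intro!: add_nonneg_nonneg mult_nonneg_nonneg late_nonneg)
  show "2 * (t + s) + 2 * angle a b + (b * late (t + s) (a - 1) b + a * late (t + s) a (b + 1))
      \<le> (a + b) * late (t + s) a b"
    using assms s by (intro late_drift) auto
next
  define r where "r = a + b"
  have "r > 0" using assms by (simp add: r_def)
  then have "((\<lambda>s. exp (- r * s) * ((t + s)\<^sup>2 + 2 * (t + s) * A + 24 * A)) \<longlongrightarrow> 0) at_top" for A
    by real_asymp
  then show "((\<lambda>s. exp (- (a + b) * s) * late (t + s) a b) \<longlongrightarrow> 0) at_top"
    by (simp add: late_def r_def)
qed measurable

text \<open>The left side is the mean of the barrier after the next jump: the factor
  \<open>a + b\<close> of the exponential density has cancelled against the denominators of the jump
  probabilities. A holding time that begins before \<open>pi\<close> is split there.\<close>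

lemma barrier_decay:
  assumes n: "0 < n" and ab: "1 \<le> a" "0 \<le> b" and t: "0 \<le> t"
  shows "(\<integral>\<^sup>+s. ennreal (exp (- (a + b) * s) *
        (b * barrier n (t + s) (a - 1) b + a * barrier n (t + s) a (b + 1)))
      * indicator {0..} s \<partial>lborel) \<le> ennreal (barrier n t a b)"
proof (cases "t < pi")
  case False
  have "(\<integral>\<^sup>+s. ennreal (exp (- (a + b) * s) *
        (b * barrier n (t + s) (a - 1) b + a * barrier n (t + s) a (b + 1)))
      * indicator {0..} s \<partial>lborel) =
      (\<integral>\<^sup>+s. ennreal (exp (- (a + b) * s) * (b * late (t + s) (a - 1) b + a * late (t + s) a (b + 1)))
      * indicator {0..} s \<partial>lborel)"
    using False by (intro nn_integral_cong) (auto simp: barrier_def split: split_indicator)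
  also have "\<dots> \<le> ennreal (exp (- (a + b) * 0) * late (t + 0) a b)"
    using False assms by (intro barrier_decay_late) auto
  finally show ?thesis using False by (simp add: barrier_def)
next
  case True
  define u where "u = pi - t"
  have u: "0 < u" "t + u = pi" using True by (auto simp: u_def)
  let ?E = "\<lambda>s. exp (- (a + b) * s) * (b * early n (t + s) (a - 1) b + a * early n (t + s) a (b + 1))"
  let ?L = "\<lambda>s. exp (- (a + b) * s) * (b * late (t + s) (a - 1) b + a * late (t + s) a (b + 1))"
  have "(\<integral>\<^sup>+s. ennreal (exp (- (a + b) * s) *
        (b * barrier n (t + s) (a - 1) b + a * barrier n (t + s) a (b + 1)))
      * indicator {0..} s \<partial>lborel) \<le>
      (\<integral>\<^sup>+s. ennreal (?E s) * indicator {0..u} s + ennreal (?L s) * indicator {u..} s \<partial>lborel)"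
    \<comment> \<open>Both closed intervals contain \<open>u\<close>; counting this point twice only
      enlarges the bound.\<close>
    using u by (intro nn_integral_mono) (auto simp: barrier_def u_def split: split_indicator)
  also have "\<dots> = (\<integral>\<^sup>+s. ennreal (?E s) * indicator {0..u} s \<partial>lborel) +
      (\<integral>\<^sup>+s. ennreal (?L s) * indicator {u..} s \<partial>lborel)"
    by (rule nn_integral_add) measurable
  also have "\<dots> \<le> (\<integral>\<^sup>+s. ennreal (?E s) * indicator {0..u} s \<partial>lborel) +
      ennreal (exp (- (a + b) * u) * late (t + u) a b)"
    using u assms by (intro add_left_mono barrier_decay_late) auto
  also have "\<dots> \<le> (\<integral>\<^sup>+s. ennreal (?E s) * indicator {0..u} s \<partial>lborel) +
      ennreal (exp (- (a + b) * u) * early n (t + u) a b)"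
    \<comment> \<open>At the switch \<open>late\<close> is replaced by the larger
      \<open>early\<close>, which then serves as terminal value on the interval from 0 to
      \<open>u\<close>.\<close>
    using assms u by (intro add_left_mono ennreal_leI mult_left_mono) (auto intro: early_pi_ge_late)
  also have "\<dots> \<le> ennreal (exp (- (a + b) * 0) * early n (t + 0) a b)"
  proof (rule nn_integral_exp_le_Icc[where f' = "\<lambda>s. early' n (t + s) a b"])
    fix s assume s: "0 \<le> s" "s \<le> u"
    show "((\<lambda>s. early n (t + s) a b) has_real_derivative early' n (t + s) a b) (at s)"
      using early_deriv[of n a b "t + s"] by (simp add: DERIV_shift add.commute)
    show "0 \<le> b * early n (t + s) (a - 1) b + a * early n (t + s) a (b + 1)"
      using assms by (auto intro!: add_nonneg_nonneg mult_nonneg_nonneg early_nonneg)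
    show "early' n (t + s) a b + (b * early n (t + s) (a - 1) b + a * early n (t + s) a (b + 1)) \<le> (a + b) * early n (t + s) a b"
      using assms s u by (intro early_drift) auto
  next
    show "(\<lambda>s. early' n (t + s) a b) \<in> borel_measurable borel"
      unfolding early'_def by measurable
  qed (use u assms early_nonneg in auto)
  finally show ?thesis using True by (simp add: barrier_def)
qed

section \<open>The barrier on the axis a = 0\<close>

text \<open>By Taylor \<open>sin x\<close> is at least \<open>x - x ^ 3 / 6\<close>, hence at least
  \<open>x / 2\<close> as \<open>x\<^sup>2 \<le> 3\<close> here. The weaker constant 20 is the
  square root of the factor 400 in \<open>early\<close>.\<close>

lemma sin_ge_twentieth:
  assumes "0 \<le> x" "x \<le> pi / 2"
  shows "x / 20 \<le> sin x"
proof -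
  have "\<bar>sin x - x\<bar> \<le> inverse (fact 3) * \<bar>x\<bar> ^ 3"
    using Maclaurin_sin_bound[of x 3] by (simp add: numeral_3_eq_3 sin_coeff_def)
  then have "x - x ^ 3 / 6 \<le> sin x"
    using assms unfolding abs_le_iff by (simp add: fact_numeral)
  moreover have "x\<^sup>2 \<le> (3.15 / 2)\<^sup>2" using assms pi_approx by (intro power_mono) auto
  then have "x * x\<^sup>2 \<le> x * 3" using assms by (intro mult_left_mono) (auto simp: power2_eq_square)
  then have "x ^ 3 \<le> x * 3" by (simp add: power2_eq_square power3_eq_cube mult.assoc)
  ultimately show ?thesis using assms by linarith
qed

text \<open>For \<open>a = 0\<close> the quadratic part of \<open>early\<close> is
  \<open>(n * cos t)\<^sup>2 + (b - n * sin t)\<^sup>2\<close>, of which the first square suffices,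
  as \<open>\<bar>cos t\<bar>\<close> is the sine of the distance from \<open>t\<close> to
  \<open>pi / 2\<close>. From \<open>pi\<close> on, \<open>angle\<close> vanishes on the axis and
  \<open>late\<close> is just \<open>t\<^sup>2\<close>.\<close>

lemma barrier_boundary:
  assumes "0 < n" "0 \<le> b" "0 \<le> t"
  shows "(t - pi / 2)\<^sup>2 \<le> barrier n t 0 b"
proof (cases "t < pi")
  case True
  have "\<bar>t - pi / 2\<bar> / 20 \<le> sin \<bar>t - pi / 2\<bar>"
    using True assms by (intro sin_ge_twentieth) (auto simp: abs_if)
  also have "\<dots> \<le> \<bar>sin \<bar>t - pi / 2\<bar>\<bar>" by simp
  also have "\<dots> = \<bar>cos t\<bar>"
    by (auto simp: abs_if sin_diff)
  finally have "(\<bar>t - pi / 2\<bar> / 20)\<^sup>2 \<le> \<bar>cos t\<bar>\<^sup>2"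
    by (intro power_mono) auto
  then have "(t - pi / 2)\<^sup>2 \<le> 400 * (cos t)\<^sup>2"
    by (simp add: power_divide)
  also have "\<dots> = 400 / n\<^sup>2 * (n * cos t)\<^sup>2"
    using assms by (simp add: power_mult_distrib)
  also have "\<dots> \<le> 400 / n\<^sup>2 * ((n * cos t)\<^sup>2 + (b - n * sin t)\<^sup>2 + exp (2 * (pi - t)) * b)"
    using assms by (intro mult_left_mono) auto
  also have "(n * cos t)\<^sup>2 + (b - n * sin t)\<^sup>2 = n\<^sup>2 * ((sin t)\<^sup>2 + (cos t)\<^sup>2) + b\<^sup>2 - 2 * n * b * sin t"
    unfolding power2_eq_square by algebra
  finally show ?thesis using True by (simp add: barrier_def early_def algebra_simps)
next
  case False
  then have "(t - pi / 2)\<^sup>2 \<le> t\<^sup>2"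
    using pi_gt_zero by (intro power_mono) linarith+
  with False show ?thesis by (simp add: barrier_def late_def angle_def)
qed

section \<open>The hitting time of the urn\<close>

text \<open>If a coordinate is zero, one of the two targets is the state itself, but its rate is
  then zero too. So the formula agrees with the value 0 of \<open>jump_prob\<close> on the
  diagonal.\<close>

lemma jump_prob_urn:
  assumes "(a, b) \<in> urn_states"
  shows "jump_prob urn_states urn_rate (a, b) y =
    ((if y = (a - sgn b, b) then real_of_int \<bar>b\<bar> else 0) +
     (if y = (a, b + sgn a) then real_of_int \<bar>a\<bar> else 0)) / real_of_int (\<bar>a\<bar> + \<bar>b\<bar>)"
  unfolding jump_prob_def exit_rate_urn[OF assms]
  by (simp add: urn_rate_def) (auto simp: sgn_if)

lemma nn_integral_jump_prob_urn:
  assumes ab: "(a, b) \<in> urn_states"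
  shows "(\<integral>\<^sup>+y. ennreal (jump_prob urn_states urn_rate (a, b) y) * f y \<partial>count_space urn_states) =
    ennreal (real_of_int \<bar>b\<bar> / real_of_int (\<bar>a\<bar> + \<bar>b\<bar>)) * f (a - sgn b, b) +
    ennreal (real_of_int \<bar>a\<bar> / real_of_int (\<bar>a\<bar> + \<bar>b\<bar>)) * f (a, b + sgn a)"
proof -
  let ?L = "(a - sgn b, b)" and ?R = "(a, b + sgn a)"
  define p where "p = real_of_int \<bar>b\<bar> / real_of_int (\<bar>a\<bar> + \<bar>b\<bar>)"
  define q where "q = real_of_int \<bar>a\<bar> / real_of_int (\<bar>a\<bar> + \<bar>b\<bar>)"
  have pq: "0 \<le> p" "0 \<le> q" by (simp_all add: p_def q_def)
  \<comment> \<open>The origin is not reached: a coordinate moves only if the other one is nonzero,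
    and that one is kept.\<close>
  have LR: "?L \<in> urn_states" "?R \<in> urn_states"
    using ab by (auto simp: urn_states_def)
  have "jump_prob urn_states urn_rate (a, b) y = (if y = ?L then p else 0) + (if y = ?R then q else 0)" for y
    unfolding jump_prob_urn[OF ab] p_def q_def by (simp add: add_divide_distrib)
  then have jump: "ennreal (jump_prob urn_states urn_rate (a, b) y) =
      ennreal p * indicator {?L} y + ennreal q * indicator {?R} y" for y
    using pq by (simp add: indicator_def)
  have "(\<integral>\<^sup>+y. ennreal (jump_prob urn_states urn_rate (a, b) y) * f y \<partial>count_space urn_states) =
      (\<integral>\<^sup>+y. (ennreal p * f y) * indicator {?L} y + (ennreal q * f y) * indicator {?R} y \<partial>count_space urn_states)"
    unfolding jump by (intro nn_integral_cong) (simp add: algebra_simps)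
  also have "\<dots> = ennreal p * f ?L + ennreal q * f ?R"
    using LR by (subst nn_integral_add) auto
  finally show ?thesis unfolding p_def q_def .
qed

locale urn_chain = jump_chain M urn_states urn_rate "(int n, 0)" Y S
  for M :: "'w measure" and n :: nat and Y S +
  assumes n_pos: "1 \<le> n"
begin

text \<open>The region that a path from \<open>(n, 0)\<close> occupies until its first coordinate
  vanishes; in it, jumps lower \<open>a\<close> or raise \<open>b\<close>.\<close>

definition quad :: "(int \<times> int) set" where "quad = {(a, b). 1 \<le> a \<and> 0 \<le> b}"

definition gap :: "int \<times> int \<Rightarrow> real" where
  "gap x = angle (real_of_int (fst x)) (real_of_int (snd x))"

definition alive :: "nat \<Rightarrow> 'w \<Rightarrow> bool" where "alive k \<omega> \<longleftrightarrow> (\<forall>i\<le>k. Y i \<omega> \<in> quad)"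

text \<open>The exit jump leads from index \<open>k\<close> to \<open>Suc k\<close>, so it happens
  at time \<open>T (Suc k)\<close>.\<close>

definition exits :: "nat \<Rightarrow> 'w \<Rightarrow> bool" where "exits k \<omega> \<longleftrightarrow> alive k \<omega> \<and> Y (Suc k) \<omega> \<notin> quad"

lemma alive_measurable[measurable]: "Measurable.pred M (alive k)"
  unfolding alive_def by measurable

lemma exits_measurable[measurable]: "Measurable.pred M (exits k)"
  unfolding exits_def by measurable

lemma alive_hist: "alive k \<omega> \<longleftrightarrow> set (hist k \<omega>) \<subseteq> quad"
  unfolding alive_def hist_def by (auto simp: less_Suc_eq_le simp del: upt_Suc)

lemma quad_states: "quad \<subseteq> urn_states"
  by (auto simp: quad_def urn_states_def)

lemma next_mean_quad:
  assumes ab: "(a, b) \<in> quad" and h[measurable]: "\<And>z. (\<lambda>t. h t z) \<in> borel_measurable borel"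
  shows "next_mean h t (a, b) =
    ennreal (real_of_int b / real_of_int (a + b)) * (\<integral>\<^sup>+s. h (t + s) (a - 1, b) \<partial>exp_law (real_of_int (a + b))) +
    ennreal (real_of_int a / real_of_int (a + b)) * (\<integral>\<^sup>+s. h (t + s) (a, b + 1) \<partial>exp_law (real_of_int (a + b)))"
proof -
  have st: "(a, b) \<in> urn_states" using ab quad_states by auto
  show ?thesis
    unfolding next_mean_def nn_integral_jump_prob_urn[OF st] exit_rate_urn[OF st]
    using ab by (auto simp: quad_def sgn_if)
qed

lemma AE_path:
  "AE \<omega> in M. (\<forall>k. 0 < S k \<omega>) \<and> Y 0 \<omega> = (int n, 0) \<and>
    (\<forall>k a b. Y k \<omega> = (a, b) \<longrightarrow> (a, b) \<in> quad \<longrightarrow>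
       Y (Suc k) \<omega> = (a - 1, b) \<or> Y (Suc k) \<omega> = (a, b + 1))"
  using AE_holding_time_pos AE_start AE_jump_pos
proof eventually_elim
  case (elim \<omega>)
  have "Y (Suc k) \<omega> = (a - 1, b) \<or> Y (Suc k) \<omega> = (a, b + 1)" if k: "Y k \<omega> = (a, b)" "(a, b) \<in> quad" for k a b
  proof -
    have "(a, b) \<in> urn_states" using k quad_states by auto
    from jump_prob_urn[OF this, of "Y (Suc k) \<omega>"] elim(3)[rule_format, of k] k show ?thesis
      by (auto simp: quad_def sgn_if split: if_splits)
  qed
  with elim show ?case by blast
qed

text \<open>A jump in the quadrant raises \<open>a + b\<close> by at most one. This bounds the exit
  rate and yields the harmonic lower bound in \<open>alive_decay\<close>.\<close>

lemma AE_alive_bound: "AE \<omega> in M. \<forall>k a b. alive k \<omega> \<longrightarrow> Y k \<omega> = (a, b) \<longrightarrow> a + b \<le> int (n + k)"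
  using AE_path
proof eventually_elim
  case (elim \<omega>)
  have "alive k \<omega> \<longrightarrow> Y k \<omega> = (a, b) \<longrightarrow> a + b \<le> int (n + k)" for k a b
  proof (induction k arbitrary: a b)
    case 0
    then show ?case using elim by auto
  next
    case (Suc k)
    show ?case
    proof (intro impI)
      assume alive: "alive (Suc k) \<omega>" and Y: "Y (Suc k) \<omega> = (a, b)"
      obtain a' b' where Y': "Y k \<omega> = (a', b')" by force
      have "alive k \<omega>" "(a', b') \<in> quad" using alive Y' by (auto simp: alive_def dest: spec[of _ k])
      then have "a' + b' \<le> int (n + k)" "Y (Suc k) \<omega> = (a' - 1, b') \<or> Y (Suc k) \<omega> = (a', b' + 1)"
        using Suc.IH Y' elim by blast+
      then show "a + b \<le> int (n + Suc k)" using Y by auto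
    qed
  qed
  then show ?case by blast
qed

section \<open>Almost sure exit from the quadrant\<close>

text \<open>This is \<open>angle_drift\<close> divided by the exit rate \<open>a + b\<close>, which
  is at most \<open>n + k\<close> after \<open>k\<close> jumps.\<close>

lemma alive_decay:
  "(\<integral>\<^sup>+\<omega>. ennreal (gap (Y (Suc k) \<omega>)) * indicator {\<omega>. alive k \<omega>} \<omega> \<partial>M) +
    ennreal (1 / real (n + k)) * emeasure M {\<omega> \<in> space M. alive k \<omega>} \<le>
   (\<integral>\<^sup>+\<omega>. ennreal (gap (Y k \<omega>)) * indicator {\<omega>. alive k \<omega>} \<omega> \<partial>M)"
proof -
  define g where "g = gap"
  \<comment> \<open>The event \<open>alive k\<close> depends on the history only, so its indicator
    may enter the test function.\<close>
  define h :: "(int \<times> int) list \<Rightarrow> real \<Rightarrow> int \<times> int \<Rightarrow> ennreal"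
    where "h l t z = ennreal (g z) * indicator {l. set l \<subseteq> quad} l" for l t z
  have [measurable]: "(\<lambda>\<omega>. ennreal (g (Y k \<omega>))) \<in> borel_measurable M" for k
    by (rule measurable_compose[OF Y_measurable]) simp
  have ind: "indicator {l. set l \<subseteq> quad} (hist k \<omega>) = (indicator {\<omega>. alive k \<omega>} \<omega> :: ennreal)" for \<omega>
    by (simp add: alive_hist indicator_def)
  have "(\<integral>\<^sup>+\<omega>. ennreal (g (Y (Suc k) \<omega>)) * indicator {\<omega>. alive k \<omega>} \<omega> \<partial>M) =
      (\<integral>\<^sup>+\<omega>. h (hist k \<omega>) (T (Suc k) \<omega>) (Y (Suc k) \<omega>) \<partial>M)"
    by (simp add: h_def ind)
  also have "\<dots> = (\<integral>\<^sup>+\<omega>. next_mean (h (hist k \<omega>)) (T k \<omega>) (Y k \<omega>) \<partial>M)"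
    by (rule markov_step) (simp add: h_def)
  finally have "(\<integral>\<^sup>+\<omega>. ennreal (g (Y (Suc k) \<omega>)) * indicator {\<omega>. alive k \<omega>} \<omega> \<partial>M) +
    ennreal (1 / real (n + k)) * emeasure M {\<omega> \<in> space M. alive k \<omega>} =
    (\<integral>\<^sup>+\<omega>. next_mean (h (hist k \<omega>)) (T k \<omega>) (Y k \<omega>) \<partial>M) +
    (\<integral>\<^sup>+\<omega>. ennreal (1 / real (n + k)) * indicator {\<omega> \<in> space M. alive k \<omega>} \<omega> \<partial>M)"
    by (subst nn_integral_cmult_indicator) auto
  also have "\<dots> = (\<integral>\<^sup>+\<omega>. next_mean (h (hist k \<omega>)) (T k \<omega>) (Y k \<omega>) +
      ennreal (1 / real (n + k)) * indicator {\<omega> \<in> space M. alive k \<omega>} \<omega> \<partial>M)"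
    by (rule nn_integral_add[symmetric]) (auto intro!: next_mean_measurable' simp: h_def)
  also have "\<dots> \<le> (\<integral>\<^sup>+\<omega>. ennreal (g (Y k \<omega>)) * indicator {\<omega>. alive k \<omega>} \<omega> \<partial>M)"
  proof (intro nn_integral_mono_AE, use AE_alive_bound AE_space in eventually_elim)
    case (elim \<omega>)
    show "next_mean (h (hist k \<omega>)) (T k \<omega>) (Y k \<omega>) +
        ennreal (1 / real (n + k)) * indicator {\<omega> \<in> space M. alive k \<omega>} \<omega>
        \<le> ennreal (g (Y k \<omega>)) * indicator {\<omega>. alive k \<omega>} \<omega>"
    proof (cases "alive k \<omega>")
      case False
      then have "h (hist k \<omega>) = (\<lambda>_ _. 0)" by (auto simp: h_def ind fun_eq_iff)
      with False elim Y_in[OF elim(2)] show ?thesis by (simp add: next_mean_const)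
    next
      case True
      obtain a b where Y: "Y k \<omega> = (a, b)" by force
      have ab: "(a, b) \<in> quad" using True Y by (auto simp: alive_def dest: spec[of _ k])
      then have ab': "1 \<le> a" "0 \<le> b" by (auto simp: quad_def)
      let ?r = "real_of_int (a + b)"
      have r: "0 < ?r" using ab' by simp
      have r_le: "?r \<le> real (n + k)"
        using elim(1) True Y by (metis of_int_le_iff of_int_of_nat_eq)
      interpret B: prob_space "exp_law ?r" using r by (rule prob_space_exponential_density)
      have "next_mean (h (hist k \<omega>)) (T k \<omega>) (Y k \<omega>) =
          ennreal (real_of_int b / ?r) * ennreal (g (a - 1, b)) +
          ennreal (real_of_int a / ?r) * ennreal (g (a, b + 1))"
        unfolding Y using True ab
        by (subst next_mean_quad) (auto simp: h_def ind B.emeasure_space_1[simplified])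
      also have "\<dots> = ennreal (real_of_int b / ?r * g (a - 1, b)) + ennreal (real_of_int a / ?r * g (a, b + 1))"
        using ab' r by (subst (1 2) ennreal_mult) (auto simp: g_def gap_def intro!: angle_nonneg)
      also have "\<dots> = ennreal (real_of_int b / ?r * g (a - 1, b) + real_of_int a / ?r * g (a, b + 1))"
        using ab' r by (subst ennreal_plus) (auto simp: g_def gap_def intro!: angle_nonneg mult_nonneg_nonneg divide_nonneg_nonneg)
      finally have mean: "next_mean (h (hist k \<omega>)) (T k \<omega>) (Y k \<omega>) =
          ennreal (real_of_int b / ?r * g (a - 1, b) + real_of_int a / ?r * g (a, b + 1))" .
      have "real_of_int b / ?r * g (a - 1, b) + real_of_int a / ?r * g (a, b + 1) + 1 / ?r \<le> g (a, b)"
      proof -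
        have "real_of_int b * (g (a - 1, b) - g (a, b)) + real_of_int a * (g (a, b + 1) - g (a, b)) \<le> - 1"
          using angle_drift[of a b] ab' by (simp add: g_def gap_def)
        then have "(real_of_int b * g (a - 1, b) + real_of_int a * g (a, b + 1) + 1) \<le> ?r * g (a, b)"
          by (simp add: algebra_simps)
        then have "(real_of_int b * g (a - 1, b) + real_of_int a * g (a, b + 1) + 1) / ?r \<le> g (a, b)"
          using r by (simp add: pos_divide_le_eq mult.commute)
        then show ?thesis by (simp add: add_divide_distrib)
      qed
      moreover have "1 / real (n + k) \<le> 1 / ?r" using r r_le by (intro divide_left_mono) auto
      ultimately have "real_of_int b / ?r * g (a - 1, b) + real_of_int a / ?r * g (a, b + 1) + 1 / real (n + k) \<le> g (a, b)"
        by linarith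
      then have "ennreal (real_of_int b / ?r * g (a - 1, b) + real_of_int a / ?r * g (a, b + 1)) + ennreal (1 / real (n + k)) \<le> ennreal (g (a, b))"
        using ab' r by (subst ennreal_plus[symmetric]) (auto simp: g_def gap_def intro!: ennreal_leI angle_nonneg add_nonneg_nonneg mult_nonneg_nonneg divide_nonneg_nonneg)
      then show ?thesis unfolding mean using True elim Y by simp
    qed
  qed
  finally show ?thesis by (simp add: g_def)
qed

text \<open>Let \<open>p\<close> be the probability of staying in \<open>quad\<close> forever.
  Telescoping \<open>alive_decay\<close> from the initial bound 12 on \<open>gap\<close> gives
  \<open>p\<close> times a tail of the harmonic series at most 12, so \<open>p = 0\<close>.\<close>

lemma AE_exits: "AE \<omega> in M. \<exists>k. exits k \<omega>"
proof -
  define p where "p = prob {\<omega> \<in> space M. \<forall>k. alive k \<omega>}"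
  let ?I = "\<lambda>k. \<integral>\<^sup>+\<omega>. ennreal (gap (Y k \<omega>)) * indicator {\<omega>. alive k \<omega>} \<omega> \<partial>M"
  have p_le: "ennreal p \<le> emeasure M {\<omega> \<in> space M. alive k \<omega>}" for k
    unfolding p_def emeasure_eq_measure by (intro ennreal_leI finite_measure_mono) auto
  have sum: "?I k + (\<Sum>j<k. ennreal (1 / real (n + j)) * ennreal p) \<le> 12" for k
  proof (induction k)
    case 0
    have "?I 0 \<le> (\<integral>\<^sup>+\<omega>. 12 \<partial>M)"
    proof (intro nn_integral_mono)
      fix \<omega>
      show "ennreal (gap (Y 0 \<omega>)) * indicator {\<omega>. alive 0 \<omega>} \<omega> \<le> 12"
      proof (cases "alive 0 \<omega>")
        case True
        obtain a b where Y: "Y 0 \<omega> = (a, b)" by force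
        have "angle a b \<le> 12" using True Y by (intro angle_le) (auto simp: alive_def quad_def)
        then have "ennreal (angle a b) \<le> ennreal 12" by (rule ennreal_leI)
        then show ?thesis using Y True by (simp add: gap_def)
      qed simp
    qed
    then show ?case by (simp add: emeasure_space_1)
  next
    case (Suc k)
    have "?I (Suc k) + ennreal (1 / real (n + k)) * ennreal p \<le>
      (\<integral>\<^sup>+\<omega>. ennreal (gap (Y (Suc k) \<omega>)) * indicator {\<omega>. alive k \<omega>} \<omega> \<partial>M) +
        ennreal (1 / real (n + k)) * emeasure M {\<omega> \<in> space M. alive k \<omega>}"
      by (intro add_mono nn_integral_mono mult_left_mono p_le) (auto simp: alive_def split: split_indicator)
    also have "\<dots> \<le> ?I k" by (rule alive_decay)
    finally have step: "?I (Suc k) + ennreal (1 / real (n + k)) * ennreal p \<le> ?I k" .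
    have "?I (Suc k) + (\<Sum>j<Suc k. ennreal (1 / real (n + j)) * ennreal p) =
        (?I (Suc k) + ennreal (1 / real (n + k)) * ennreal p) + (\<Sum>j<k. ennreal (1 / real (n + j)) * ennreal p)"
      by (simp only: sum.lessThan_Suc add_ac)
    also have "\<dots> \<le> ?I k + (\<Sum>j<k. ennreal (1 / real (n + j)) * ennreal p)"
      using step by (rule add_right_mono)
    finally show ?case using Suc by (rule order_trans)
  qed
  have "p = 0"
  proof (rule ccontr)
    assume "p \<noteq> 0"
    then have p: "0 < p" by (simp add: p_def zero_less_measure_iff measure_le_0_iff less_le)
    have "(\<Sum>j<k. 1 / real (n + j)) \<le> 12 / p" for k
    proof -
      have "ennreal ((\<Sum>j<k. 1 / real (n + j)) * p) = (\<Sum>j<k. ennreal (1 / real (n + j)) * ennreal p)"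
        using p unfolding sum_distrib_right
        by (simp only: ennreal_mult[symmetric] divide_nonneg_nonneg zero_le_one of_nat_0_le_iff less_imp_le)
          (simp add: sum_ennreal)
      also have "\<dots> \<le> ?I k + (\<Sum>j<k. ennreal (1 / real (n + j)) * ennreal p)" by simp
      also have "\<dots> \<le> ennreal 12" using sum[of k] by simp
      finally have "(\<Sum>j<k. 1 / real (n + j)) * p \<le> 12" by (subst (asm) ennreal_le_iff) auto
      then show ?thesis using p by (simp add: pos_le_divide_eq)
    qed
    then have "summable (\<lambda>j. 1 / real (n + j))"
      by (intro summableI_nonneg_bounded[where x = "12 / p"]) auto
    then have "summable (\<lambda>j. inverse (real (j + n)))" by (simp add: inverse_eq_divide add.commute)
    then have "summable (\<lambda>j. inverse (real j))" by (subst (asm) summable_iff_shift)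
    then show False using not_summable_harmonic[where 'a = real] by simp
  qed
  then have "AE \<omega> in M. \<not> (\<forall>k. alive k \<omega>)"
    unfolding p_def by (subst (asm) prob_eq_0) auto
  then show ?thesis
    using AE_path
  proof eventually_elim
    case (elim \<omega>)
    \<comment> \<open>The first index outside \<open>quad\<close>. It is not 0, as the start
      \<open>(n, 0)\<close> lies in \<open>quad\<close>, and its predecessor is the exit
      index.\<close>
    define k where "k = (LEAST k. \<not> alive k \<omega>)"
    have k: "\<not> alive k \<omega>" using elim(1) unfolding k_def by (metis LeastI)
    have "alive 0 \<omega>" using elim(2) n_pos by (auto simp: alive_def quad_def)
    then obtain j where j: "k = Suc j" using k by (cases k) auto
    then have "alive j \<omega>" using not_less_Least[of j "\<lambda>k. \<not> alive k \<omega>"] by (auto simp: k_def)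
    moreover then have "Y (Suc j) \<omega> \<notin> quad" using k j by (auto simp: alive_def le_Suc_eq)
    ultimately show ?case unfolding exits_def by blast
  qed
qed


section \<open>The stopped barrier as a supermartingale\<close>

definition bar :: "real \<Rightarrow> int \<times> int \<Rightarrow> real" where
  "bar t x = barrier (real n) t (real_of_int (fst x)) (real_of_int (snd x))"

lemma bar_measurable[measurable]: "(\<lambda>t. bar t x) \<in> borel_measurable borel"
  unfolding bar_def by measurable

lemma bar_measurable'[measurable]: "(\<lambda>\<omega>. bar (T k \<omega>) (Y k \<omega>)) \<in> borel_measurable M"
  by (rule measurable_compose_countable[where g = "Y k"]) measurable

lemma next_mean_bar:
  assumes ab: "(a, b) \<in> quad" and t: "0 \<le> t"
  shows "next_mean (\<lambda>t z. ennreal (bar t z)) t (a, b) \<le> ennreal (bar t (a, b))"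
proof -
  have ab': "1 \<le> a" "0 \<le> b" using ab by (auto simp: quad_def)
  define r where "r = real_of_int (a + b)"
  have r: "0 < r" using ab' by (simp add: r_def)
  have nonneg: "0 \<le> bar s (a - 1, b)" "0 \<le> bar s (a, b + 1)" for s
    using ab' by (auto simp: bar_def intro!: barrier_nonneg)
  \<comment> \<open>The rate \<open>r\<close> in the exponential density cancels against the
    denominator of the jump probability \<open>c / r\<close>, which gives the form treated by
    \<open>barrier_decay\<close>.\<close>
  have *: "ennreal (c / r) * (\<integral>\<^sup>+s. ennreal (f s) \<partial>exp_law r) =
      (\<integral>\<^sup>+s. ennreal (exp (- r * s) * (c * f s)) * indicator {0..} s \<partial>lborel)"
    if c: "0 \<le> c" and f: "\<And>s. 0 \<le> f s" and [measurable]: "f \<in> borel_measurable borel" for c f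
  proof -
    have "ennreal (c / r) * (\<integral>\<^sup>+s. ennreal (f s) \<partial>exp_law r) =
        (\<integral>\<^sup>+s. ennreal (c / r) * (ennreal (exponential_density r s) * ennreal (f s)) \<partial>lborel)"
      by (subst nn_integral_density) (auto simp: nn_integral_cmult)
    also have "\<dots> = (\<integral>\<^sup>+s. ennreal (exp (- r * s) * (c * f s)) * indicator {0..} s \<partial>lborel)"
    proof (intro nn_integral_cong)
      fix s
      show "ennreal (c / r) * (ennreal (exponential_density r s) * ennreal (f s)) =
          ennreal (exp (- r * s) * (c * f s)) * indicator {0..} s"
        using r c f[of s]
        by (auto simp: exponential_density_def ennreal_mult[symmetric] mult_ac split: split_indicator)
    qed
    finally show ?thesis .
  qed
  have "next_mean (\<lambda>t z. ennreal (bar t z)) t (a, b) =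
      ennreal (real_of_int b / r) * (\<integral>\<^sup>+s. ennreal (bar (t + s) (a - 1, b)) \<partial>exp_law r) +
      ennreal (real_of_int a / r) * (\<integral>\<^sup>+s. ennreal (bar (t + s) (a, b + 1)) \<partial>exp_law r)"
    unfolding r_def using ab by (intro next_mean_quad) measurable
  also have "\<dots> =
      (\<integral>\<^sup>+s. ennreal (exp (- r * s) * (real_of_int b * bar (t + s) (a - 1, b))) * indicator {0..} s \<partial>lborel) +
      (\<integral>\<^sup>+s. ennreal (exp (- r * s) * (real_of_int a * bar (t + s) (a, b + 1))) * indicator {0..} s \<partial>lborel)"
    using ab' nonneg by (intro arg_cong2[where f = "(+)"] *) auto
  also have "\<dots> = (\<integral>\<^sup>+s. ennreal (exp (- r * s) * (real_of_int b * bar (t + s) (a - 1, b))) * indicator {0..} s +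
      ennreal (exp (- r * s) * (real_of_int a * bar (t + s) (a, b + 1))) * indicator {0..} s \<partial>lborel)"
    by (rule nn_integral_add[symmetric]) measurable
  also have "\<dots> = (\<integral>\<^sup>+s. ennreal (exp (- r * s) *
      (real_of_int b * bar (t + s) (a - 1, b) + real_of_int a * bar (t + s) (a, b + 1))) * indicator {0..} s \<partial>lborel)"
    using ab' nonneg
    by (intro nn_integral_cong) (auto simp: distrib_left ennreal_plus split: split_indicator)
  also have "\<dots> \<le> ennreal (bar t (a, b))"
    using barrier_decay[of "real n" a b t] n_pos ab' t by (simp add: bar_def r_def)
  finally show ?thesis .
qed

lemma AE_T_nonneg: "AE \<omega> in M. \<forall>k. 0 \<le> T k \<omega>"
  using AE_holding_time_pos by eventually_elim (auto simp: T_def intro!: sum_nonneg intro: less_imp_le)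

text \<open>The supermartingale inequality at jump times, restricted to paths still in the quadrant;
  histories outside it have test function 0.\<close>

lemma bar_decay:
  "(\<integral>\<^sup>+\<omega>. ennreal (bar (T (Suc k) \<omega>) (Y (Suc k) \<omega>)) * indicator {\<omega>. alive k \<omega>} \<omega> \<partial>M) \<le>
   (\<integral>\<^sup>+\<omega>. ennreal (bar (T k \<omega>) (Y k \<omega>)) * indicator {\<omega>. alive k \<omega>} \<omega> \<partial>M)"
proof -
  define h :: "(int \<times> int) list \<Rightarrow> real \<Rightarrow> int \<times> int \<Rightarrow> ennreal"
    where "h l t z = ennreal (bar t z) * indicator {l. set l \<subseteq> quad} l" for l t z
  have ind: "indicator {l. set l \<subseteq> quad} (hist k \<omega>) = (indicator {\<omega>. alive k \<omega>} \<omega> :: ennreal)" for \<omega>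
    by (simp add: alive_hist indicator_def)
  have "(\<integral>\<^sup>+\<omega>. ennreal (bar (T (Suc k) \<omega>) (Y (Suc k) \<omega>)) * indicator {\<omega>. alive k \<omega>} \<omega> \<partial>M) =
      (\<integral>\<^sup>+\<omega>. h (hist k \<omega>) (T (Suc k) \<omega>) (Y (Suc k) \<omega>) \<partial>M)"
    by (simp add: h_def ind)
  also have "\<dots> = (\<integral>\<^sup>+\<omega>. next_mean (h (hist k \<omega>)) (T k \<omega>) (Y k \<omega>) \<partial>M)"
    by (rule markov_step) (simp add: h_def)
  also have "\<dots> \<le> (\<integral>\<^sup>+\<omega>. ennreal (bar (T k \<omega>) (Y k \<omega>)) * indicator {\<omega>. alive k \<omega>} \<omega> \<partial>M)"
  proof (intro nn_integral_mono_AE, use AE_T_nonneg AE_space in eventually_elim)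
    case (elim \<omega>)
    show "next_mean (h (hist k \<omega>)) (T k \<omega>) (Y k \<omega>)
        \<le> ennreal (bar (T k \<omega>) (Y k \<omega>)) * indicator {\<omega>. alive k \<omega>} \<omega>"
    proof (cases "alive k \<omega>")
      case False
      then have "h (hist k \<omega>) = (\<lambda>_ _. 0)" by (auto simp: h_def ind fun_eq_iff)
      with Y_in[OF elim(2)] show ?thesis by (simp add: next_mean_const)
    next
      case True
      obtain a b where Y: "Y k \<omega> = (a, b)" by force
      have ab: "(a, b) \<in> quad" using True Y by (auto simp: alive_def dest: spec[of _ k])
      have "h (hist k \<omega>) = (\<lambda>t z. ennreal (bar t z))" using True by (auto simp: h_def ind fun_eq_iff)
      with next_mean_bar[OF ab, of "T k \<omega>"] elim(1) True Y show ?thesis by simp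
    qed
  qed
  finally show ?thesis .
qed

text \<open>Raising \<open>b\<close> keeps the path in \<open>quad\<close>, so it can only leave by
  lowering \<open>a\<close> from 1 to 0. This puts the exit state on the axis treated by
  \<open>barrier_boundary\<close>.\<close>

lemma AE_exit_state: "AE \<omega> in M. \<forall>k. exits k \<omega> \<longrightarrow> (\<exists>b\<ge>0. Y (Suc k) \<omega> = (0, b))"
  using AE_path
proof eventually_elim
  case (elim \<omega>)
  show ?case
  proof (intro allI impI)
    fix k assume k: "exits k \<omega>"
    obtain a b where Y: "Y k \<omega> = (a, b)" by force
    have "(a, b) \<in> quad" using k Y by (auto simp: exits_def alive_def dest: spec[of _ k])
    moreover have "Y (Suc k) \<omega> = (a - 1, b) \<or> Y (Suc k) \<omega> = (a, b + 1)"
      using elim Y \<open>(a, b) \<in> quad\<close> by blast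
    ultimately show "\<exists>b\<ge>0. Y (Suc k) \<omega> = (0, b)"
      using k by (auto simp: exits_def quad_def)
  qed
qed

text \<open>After each jump the mass of the barrier splits into paths still alive and paths that
  have just left, for which the barrier dominates the squared deviation. Telescoping bounds the
  total cost by the initial value of the barrier.\<close>

lemma sum_exit_cost:
  "(\<Sum>j<k. \<integral>\<^sup>+\<omega>. ennreal ((T (Suc j) \<omega> - pi / 2)\<^sup>2) * indicator {\<omega>. exits j \<omega>} \<omega> \<partial>M) \<le>
    ennreal (400 * exp (2 * pi) / real n)"
proof -
  let ?J = "\<lambda>k. \<integral>\<^sup>+\<omega>. ennreal (bar (T k \<omega>) (Y k \<omega>)) * indicator {\<omega>. alive k \<omega>} \<omega> \<partial>M"
  let ?c = "\<lambda>j. \<integral>\<^sup>+\<omega>. ennreal ((T (Suc j) \<omega> - pi / 2)\<^sup>2) * indicator {\<omega>. exits j \<omega>} \<omega> \<partial>M"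
  have step: "?J (Suc k) + ?c k \<le> ?J k" for k
  proof -
    have "?J (Suc k) + ?c k =
      (\<integral>\<^sup>+\<omega>. ennreal (bar (T (Suc k) \<omega>) (Y (Suc k) \<omega>)) * indicator {\<omega>. alive (Suc k) \<omega>} \<omega> +
        ennreal ((T (Suc k) \<omega> - pi / 2)\<^sup>2) * indicator {\<omega>. exits k \<omega>} \<omega> \<partial>M)"
      by (rule nn_integral_add[symmetric]) measurable
    also have "\<dots> \<le> (\<integral>\<^sup>+\<omega>. ennreal (bar (T (Suc k) \<omega>) (Y (Suc k) \<omega>)) * indicator {\<omega>. alive k \<omega>} \<omega> \<partial>M)"
    proof (intro nn_integral_mono_AE, use AE_T_nonneg AE_exit_state in eventually_elim)
      case (elim \<omega>)
      show ?case
      proof (cases "exits k \<omega>")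
        case True
        then obtain b where b: "0 \<le> b" "Y (Suc k) \<omega> = (0, b)" using elim(2) by blast
        have "(T (Suc k) \<omega> - pi / 2)\<^sup>2 \<le> bar (T (Suc k) \<omega>) (Y (Suc k) \<omega>)"
          using barrier_boundary[of "real n" b "T (Suc k) \<omega>"] b n_pos elim(1) by (simp add: bar_def)
        moreover have "\<not> alive (Suc k) \<omega>" "alive k \<omega>"
          using True by (auto simp: exits_def alive_def)
        ultimately show ?thesis using True by (simp add: ennreal_leI)
      next
        case False
        then show ?thesis by (auto simp: alive_def split: split_indicator)
      qed
    qed
    also have "\<dots> \<le> ?J k" by (rule bar_decay)
    finally show ?thesis .
  qed
  have "?J k + (\<Sum>j<k. ?c j) \<le> ?J 0"
  proof (induction k)
    case (Suc k)
    have "?J (Suc k) + (\<Sum>j<Suc k. ?c j) = (?J (Suc k) + ?c k) + (\<Sum>j<k. ?c j)"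
      by (simp only: sum.lessThan_Suc add_ac)
    also have "\<dots> \<le> ?J k + (\<Sum>j<k. ?c j)" using step by (rule add_right_mono)
    finally show ?case using Suc by (rule order_trans)
  qed simp
  also have "?J 0 \<le> (\<integral>\<^sup>+\<omega>. ennreal (400 * exp (2 * pi) / real n) \<partial>M)"
  proof (intro nn_integral_mono_AE, use AE_start in eventually_elim)
    case (elim \<omega>)
    \<comment> \<open>At time 0 in \<open>(n, 0)\<close> the quadratic part of \<open>early\<close>
      vanishes and only the exponential term \<open>exp (2 * pi) * n\<close> is left.\<close>
    have "bar (T 0 \<omega>) (Y 0 \<omega>) = 400 * exp (2 * pi) / real n"
      using n_pos unfolding elim
      by (simp add: T_def bar_def barrier_def early_def power2_eq_square algebra_simps)
    then show ?case by (auto split: split_indicator)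
  qed
  finally have "?J k + (\<Sum>j<k. ?c j) \<le> ennreal (400 * exp (2 * pi) / real n)"
    by (simp add: emeasure_space_1)
  then show ?thesis by (rule order_trans[rotated]) simp
qed

section \<open>The hitting time and its second moment\<close>

text \<open>By \<open>exits_unique\<close> at most one term is nonzero. The series makes
  measurability immediate; its value is 0 on the null event that the path never leaves
  \<open>quad\<close>.\<close>

definition hit_time :: "'w \<Rightarrow> real" where
  "hit_time \<omega> = (\<Sum>j. if exits j \<omega> then T (Suc j) \<omega> else 0)"

lemma hit_time_measurable[measurable]: "hit_time \<in> borel_measurable M"
  unfolding hit_time_def by measurable

lemma exits_unique: "exits i \<omega> \<Longrightarrow> exits j \<omega> \<Longrightarrow> i = j"
proof (induction i j rule: linorder_wlog)
  case (le i j)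
  show ?case
  proof (rule ccontr)
    assume "i \<noteq> j"
    with le have "Suc i \<le> j" by simp
    with le show False by (auto simp: exits_def alive_def)
  qed
qed simp

lemma hit_time_eq: assumes "exits j \<omega>" shows "hit_time \<omega> = T (Suc j) \<omega>"
proof -
  have "(if exits i \<omega> then T (Suc i) \<omega> else 0) = (if i = j then T (Suc j) \<omega> else 0)" for i
    using assms exits_unique by metis
  then have "hit_time \<omega> = (\<Sum>i. if i = j then T (Suc j) \<omega> else 0)" by (simp only: hit_time_def)
  also have "\<dots> = (\<Sum>i\<in>{j}. if i = j then T (Suc j) \<omega> else 0)"
    by (rule suminf_finite) auto
  finally show ?thesis by simp
qed

lemma second_moment:
  "(\<integral>\<^sup>+\<omega>. ennreal ((hit_time \<omega> - pi / 2)\<^sup>2) \<partial>M) \<le> ennreal (400 * exp (2 * pi) / real n)"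
proof -
  let ?f = "\<lambda>j \<omega>. ennreal ((T (Suc j) \<omega> - pi / 2)\<^sup>2) * indicator {\<omega>. exits j \<omega>} \<omega>"
  have "(\<integral>\<^sup>+\<omega>. ennreal ((hit_time \<omega> - pi / 2)\<^sup>2) \<partial>M) \<le> (\<integral>\<^sup>+\<omega>. (\<Sum>j. ?f j \<omega>) \<partial>M)"
  proof (intro nn_integral_mono_AE, use AE_exits in eventually_elim)
    case (elim \<omega>)
    then obtain j where j: "exits j \<omega>" by blast
    have "ennreal ((hit_time \<omega> - pi / 2)\<^sup>2) = (\<Sum>i\<in>{j}. ?f i \<omega>)" using j by (simp add: hit_time_eq)
    also have "\<dots> \<le> (\<Sum>j. ?f j \<omega>)" by (rule sum_le_suminf) auto
    finally show ?case .
  qed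
  also have "\<dots> = (\<Sum>j. \<integral>\<^sup>+\<omega>. ?f j \<omega> \<partial>M)" by (rule nn_integral_suminf) measurable
  also have "\<dots> \<le> ennreal (400 * exp (2 * pi) / real n)"
    by (rule suminf_le_const) (auto intro: sum_exit_cost)
  finally show ?thesis .
qed

text \<open>Up to the exit jump every visited state has first coordinate at least 1, and that jump
  puts it to 0. Times before the exit lie in one of finitely many holding intervals, so the
  behaviour of the process after a possible explosion does not matter.\<close>

lemma AE_tau_f:
  assumes X: "AE \<omega> in M. \<forall>k t. (\<Sum>i<k. S i \<omega>) \<le> t \<and> t < (\<Sum>i<Suc k. S i \<omega>) \<longrightarrow> (A t \<omega>, B t \<omega>) = Y k \<omega>"
  shows "AE \<omega> in M. 0 \<le> hit_time \<omega> \<and> tau_f A \<omega> = ereal (hit_time \<omega>)"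
  using X AE_path AE_exits AE_exit_state AE_T_nonneg
proof eventually_elim
  case (elim \<omega>)
  obtain j where j: "exits j \<omega>" using elim(3) by blast
  obtain b where b: "Y (Suc j) \<omega> = (0, b)" using elim(4) j by blast
  have X: "(A t \<omega>, B t \<omega>) = Y k \<omega>" if "T k \<omega> \<le> t" "t < T (Suc k) \<omega>" for k t
    using elim(1) that unfolding T_def by blast
  have Suc: "T (Suc k) \<omega> = T k \<omega> + S k \<omega>" and S: "0 < S k \<omega>" for k
    using elim(2) by (simp_all add: T_def)
  \<comment> \<open>The holding time in the exit state is positive, so its half-open holding
    interval contains the left endpoint \<open>T (Suc j)\<close>.\<close>
  have "A (T (Suc j) \<omega>) \<omega> = 0"
    using X[of "Suc j" "T (Suc j) \<omega>"] Suc[of "Suc j"] S[of "Suc j"] b by simp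
  moreover have "T (Suc j) \<omega> \<le> t" if t: "0 \<le> t" "A t \<omega> = 0" for t
  proof (rule ccontr)
    assume "\<not> T (Suc j) \<omega> \<le> t"
    then have less: "t < T (Suc j) \<omega>" by simp
    \<comment> \<open>The index of the holding interval that contains \<open>t\<close>.\<close>
    define k where "k = (LEAST k. t < T (Suc k) \<omega>)"
    have k: "t < T (Suc k) \<omega>" unfolding k_def using less by (rule LeastI)
    have "k \<le> j" unfolding k_def using less by (rule Least_le)
    have "T k \<omega> \<le> t"
    proof (cases k)
      case 0
      then show ?thesis using t by (simp add: T_def)
    next
      case (Suc i)
      then have "\<not> t < T (Suc i) \<omega>" unfolding k_def by (metis lessI not_less_Least)
      then show ?thesis using Suc by simp
    qed
    then have "Y k \<omega> = (0, B t \<omega>)" using X[OF _ k] t by simp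
    moreover have "Y k \<omega> \<in> quad" using j \<open>k \<le> j\<close> by (auto simp: exits_def alive_def)
    ultimately show False by (simp add: quad_def)
  qed
  ultimately have "tau_f A \<omega> = ereal (T (Suc j) \<omega>)"
    unfolding tau_f_def using elim(5)
    by (intro antisym Inf_lower Inf_greatest) auto
  then show ?case using hit_time_eq[OF j] elim(5) by simp
qed

end

section \<open>Transfer to the fast embedding and asymptotics\<close>

text \<open>The witnesses of \<open>ctmc_from\<close> form an \<open>urn_chain\<close>. The
  measurable real function \<open>R\<close> stands in for the extended-real \<open>tau_f\<close>,
  for which no measurability is assumed.\<close>

lemma fast_embedding_hitting_time:
  assumes n: "1 \<le> n" and fe: "fast_embedding M (int n, 0) A B"
  shows "\<exists>R \<in> borel_measurable M. prob_space M \<and> (AE \<omega> in M. 0 \<le> R \<omega> \<and> tau_f A \<omega> = ereal (R \<omega>)) \<and>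
    (\<integral>\<^sup>+\<omega>. ennreal ((R \<omega> - pi / 2)\<^sup>2) \<partial>M) \<le> ennreal (400 * exp (2 * pi) / real n)"
proof -
  from fe obtain Y S where prob: "prob_space M"
    and Y: "\<And>k. Y k \<in> measurable M (count_space urn_states)"
    and S: "\<And>k. S k \<in> borel_measurable M"
    and X: "AE \<omega> in M. \<forall>k t. (\<Sum>i<k. S i \<omega>) \<le> t \<and> t < (\<Sum>i<Suc k. S i \<omega>) \<longrightarrow> (A t \<omega>, B t \<omega>) = Y k \<omega>"
    and law: "\<forall>k (y :: nat \<Rightarrow> int \<times> int) (s :: nat \<Rightarrow> real).
           (\<forall>i\<le>k. y i \<in> urn_states) \<longrightarrow> (\<forall>i<k. 0 \<le> s i) \<longrightarrow>
           measure M {\<omega> \<in> space M. (\<forall>i\<le>k. Y i \<omega> = y i) \<and> (\<forall>i<k. s i < S i \<omega>)} =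
             (if y 0 = (int n, 0) then 1 else 0) *
             (\<Prod>i<k. jump_prob urn_states urn_rate (y i) (y (Suc i)) * exp (- exit_rate urn_states urn_rate (y i) * s i))"
    unfolding fast_embedding_def ctmc_from_def by blast
  interpret urn_chain M n Y S
  proof (intro urn_chain.intro jump_chain.intro jump_chain_axioms.intro urn_chain_axioms.intro prob)
    show "(int n, 0) \<in> urn_states" using n by (auto simp: urn_states_def)
    show "1 \<le> n" by fact
    show "Y k \<in> measurable M (count_space urn_states)" "S k \<in> borel_measurable M" for k by fact+
  next
    fix k and y :: "nat \<Rightarrow> int \<times> int" and s :: "nat \<Rightarrow> real"
    assume "\<And>i. i \<le> k \<Longrightarrow> y i \<in> urn_states" "\<And>i. i < k \<Longrightarrow> 0 \<le> s i"
    then show "measure M {\<omega> \<in> space M. (\<forall>i\<le>k. Y i \<omega> = y i) \<and> (\<forall>i<k. s i < S i \<omega>)} =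
             (if y 0 = (int n, 0) then 1 else 0) *
             (\<Prod>i<k. jump_prob urn_states urn_rate (y i) (y (Suc i)) * exp (- exit_rate urn_states urn_rate (y i) * s i))"
      using law by blast
  next
    fix x :: "int \<times> int" assume x: "x \<in> urn_states"
    obtain a b where ab: "x = (a, b)" by force
    have pos: "0 < real_of_int (\<bar>a\<bar> + \<bar>b\<bar>)"
      using x ab unfolding of_int_0_less_iff by (auto simp: urn_states_def)
    show "0 < exit_rate urn_states urn_rate x"
      using x ab exit_rate_urn[of a b] pos by simp
    show "0 \<le> jump_prob urn_states urn_rate x z" for z
      using x ab by (simp add: jump_prob_urn)
    have "real_of_int \<bar>b\<bar> / real_of_int (\<bar>a\<bar> + \<bar>b\<bar>) + real_of_int \<bar>a\<bar> / real_of_int (\<bar>a\<bar> + \<bar>b\<bar>) = 1"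
      using pos by (simp add: add_divide_distrib[symmetric] add.commute)
    then show "(\<integral>\<^sup>+z. ennreal (jump_prob urn_states urn_rate x z) \<partial>count_space urn_states) = 1"
      using nn_integral_jump_prob_urn[of a b "\<lambda>_. 1"] x ab
      by (simp add: ennreal_plus[symmetric] del: ennreal_plus of_int_add of_int_abs)
  qed
  show ?thesis
    using prob AE_tau_f[OF X] second_moment by (intro bexI[of _ hit_time]) auto
qed

text \<open>The bound is the pointwise inequality \<open>2 \<bar>x\<bar> \<le> e + x\<^sup>2 / e\<close>, to be used with \<open>e\<close> close to \<open>sqrt c\<close>.\<close>

lemma (in prob_space) abs_expectation_le:
  fixes X :: "'a \<Rightarrow> real"
  assumes [measurable]: "X \<in> borel_measurable M" and "0 \<le> c" and "0 < e"
    and X: "(\<integral>\<^sup>+\<omega>. ennreal ((X \<omega>)\<^sup>2) \<partial>M) \<le> ennreal c"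
  shows "integrable M X" and "\<bar>expectation X\<bar> \<le> (e + c / e) / 2"
proof -
  have sq: "integrable M (\<lambda>\<omega>. (X \<omega>)\<^sup>2)"
    using X by (intro integrableI_nonneg) (auto intro: le_less_trans)
  have "expectation (\<lambda>\<omega>. (X \<omega>)\<^sup>2) \<le> c"
    using X sq \<open>0 \<le> c\<close> by (simp add: nn_integral_eq_integral)
  have le: "\<bar>X \<omega>\<bar> \<le> (e + (X \<omega>)\<^sup>2 / e) / 2" for \<omega>
  proof -
    have "0 \<le> (\<bar>X \<omega>\<bar> - e)\<^sup>2" by simp
    then have "2 * e * \<bar>X \<omega>\<bar> \<le> e * e + (X \<omega>)\<^sup>2"
      by (simp add: power2_diff power2_eq_square algebra_simps)
    then show ?thesis using \<open>0 < e\<close> by (simp add: field_simps)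
  qed
  have int: "integrable M (\<lambda>\<omega>. (e + (X \<omega>)\<^sup>2 / e) / 2)" using sq by simp
  show X: "integrable M X"
    by (rule Bochner_Integration.integrable_bound[OF int]) (use order_trans[OF le abs_ge_self] in auto)
  have "\<bar>expectation X\<bar> \<le> expectation (\<lambda>\<omega>. \<bar>X \<omega>\<bar>)" by (rule integral_abs_bound)
  also have "\<dots> \<le> expectation (\<lambda>\<omega>. (e + (X \<omega>)\<^sup>2 / e) / 2)"
    using X int le by (intro integral_mono) auto
  also have "\<dots> = (e + expectation (\<lambda>\<omega>. (X \<omega>)\<^sup>2) / e) / 2"
    using sq by (simp add: prob_space)
  also have "\<dots> \<le> (e + c / e) / 2"
    using \<open>expectation (\<lambda>\<omega>. (X \<omega>)\<^sup>2) \<le> c\<close> \<open>0 < e\<close> by (intro divide_right_mono add_left_mono) auto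
  finally show "\<bar>expectation X\<bar> \<le> (e + c / e) / 2" .
qed

lemma fast_embedding_moments:
  assumes n: "1 \<le> n" and fe: "fast_embedding M (int n, 0) A B"
  defines "C \<equiv> 400 * exp (2 * pi)"
  shows "expect M (tau_f A) < \<infinity>"
    and "\<bar>enn2real (expect M (tau_f A)) - pi / 2\<bar> \<le> (1 + C) * real n powr (- 1 / 2)"
    and "expect M (\<lambda>\<omega>. \<bar>tau_f A \<omega> - ereal (pi / 2)\<bar> ^ 2) \<le> ennreal (C * real n powr (- 1 / 2))"
proof -
  obtain R where [measurable]: "R \<in> borel_measurable M" and "prob_space M"
    and R: "AE \<omega> in M. 0 \<le> R \<omega> \<and> tau_f A \<omega> = ereal (R \<omega>)"
    and sq: "(\<integral>\<^sup>+\<omega>. ennreal ((R \<omega> - pi / 2)\<^sup>2) \<partial>M) \<le> ennreal (C / real n)"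
    using fast_embedding_hitting_time[OF n fe] unfolding C_def by blast
  interpret prob_space M by fact
  have C: "0 < C" by (simp add: C_def)
  \<comment> \<open>This is the order of the square root of \<open>C / n\<close>: with it
    \<open>C / n / e\<close> equals \<open>C * e\<close>, so both terms of
    \<open>abs_expectation_le\<close> have order \<open>e\<close>.\<close>
  define e where "e = real n powr (- 1 / 2)"
  have e: "0 < e" "e * e = 1 / real n"
    using n by (auto simp: e_def powr_add[symmetric] powr_minus_divide)
  have Cn: "C / real n = C * (e * e)" using e by simp
  have "e \<le> 1" unfolding e_def using n powr_mono[of "- 1 / 2" 0 "real n"] by simp
  note abs = abs_expectation_le[of "\<lambda>\<omega>. R \<omega> - pi / 2" "C / real n" e]
  have int': "integrable M (\<lambda>\<omega>. R \<omega> - pi / 2)"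
    using sq e C by (intro abs(1)) auto
  have "\<bar>expectation (\<lambda>\<omega>. R \<omega> - pi / 2)\<bar> \<le> (e + C / real n / e) / 2"
    using sq e C by (intro abs(2)) auto
  also have "C / real n / e = C * e"
    using e(1) by (simp add: Cn)
  finally have dev: "\<bar>expectation (\<lambda>\<omega>. R \<omega> - pi / 2)\<bar> \<le> (1 + C) * e"
    using e(1) mult_pos_pos[OF C e(1)] by (simp add: distrib_right)
  have int: "integrable M R"
    using Bochner_Integration.integrable_add[OF int' integrable_const[of "pi / 2"]] by simp
  have tau: "expect M (tau_f A) = ennreal (expectation R)"
  proof -
    have "expect M (tau_f A) = (\<integral>\<^sup>+\<omega>. ennreal (R \<omega>) \<partial>M)"
      unfolding expect_def using R by (intro nn_integral_cong_AE) (auto simp: e2ennreal_ereal)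
    also have "\<dots> = ennreal (expectation R)"
      using R int by (intro nn_integral_eq_integral) auto
    finally show ?thesis .
  qed
  show "expect M (tau_f A) < \<infinity>" by (simp add: tau)
  have "0 \<le> expectation R" using R by (intro integral_nonneg_AE) auto
  then show "\<bar>enn2real (expect M (tau_f A)) - pi / 2\<bar> \<le> (1 + C) * real n powr (- 1 / 2)"
    using dev int by (simp add: tau e_def prob_space)
  have "expect M (\<lambda>\<omega>. \<bar>tau_f A \<omega> - ereal (pi / 2)\<bar> ^ 2) = (\<integral>\<^sup>+\<omega>. ennreal ((R \<omega> - pi / 2)\<^sup>2) \<partial>M)"
    unfolding expect_def using R by (intro nn_integral_cong_AE) (auto simp: e2ennreal_ereal)
  also have "\<dots> \<le> ennreal (C / real n)" by (rule sq)
  \<comment> \<open>The second moment has order \<open>e * e\<close>; since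
    \<open>e \<le> 1\<close>, it is also bounded at the rate claimed for the mean.\<close>
  also have "\<dots> \<le> ennreal (C * e)"
    unfolding Cn using e(1) C \<open>e \<le> 1\<close> by (intro ennreal_leI mult_left_mono) auto
  finally show "expect M (\<lambda>\<omega>. \<bar>tau_f A \<omega> - ereal (pi / 2)\<bar> ^ 2) \<le> ennreal (C * real n powr (- 1 / 2))"
    by (simp add: e_def)
qed

theorem theorem2p14:
  fixes M :: "nat \<Rightarrow> 'w measure" and A B :: "nat \<Rightarrow> real \<Rightarrow> 'w \<Rightarrow> int" and \<delta> :: real
  assumes "\<And>n. n \<ge> 1 \<Longrightarrow> fast_embedding (M n) (int n, 0) (A n) (B n)"
    and "\<delta> > 0"
  shows "(\<forall>\<^sub>F n in sequentially. expect (M n) (tau_f (A n)) < \<infinity>) \<and>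
    (\<lambda>n. enn2real (expect (M n) (tau_f (A n))) - pi / 2) \<in> O(\<lambda>n. real n powr (\<delta> - 1 / 2)) \<and>
    (\<forall>\<^sub>F n in sequentially.
       expect (M n) (\<lambda>\<omega>. \<bar>tau_f (A n) \<omega> - ereal (pi / 2)\<bar> ^ 2) < \<infinity>) \<and>
    (\<lambda>n. enn2real (expect (M n) (\<lambda>\<omega>. \<bar>tau_f (A n) \<omega> - ereal (pi / 2)\<bar> ^ 2)))
      \<in> O(\<lambda>n. real n powr (\<delta> - 1 / 2))"
proof -
  let ?C = "400 * exp (2 * pi)"
  have ev: "eventually (\<lambda>n. 1 \<le> n) sequentially" by (rule eventually_ge_at_top)
  have powr: "real n powr (- 1 / 2) \<le> real n powr (\<delta> - 1 / 2)" if "1 \<le> n" for n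
    using that \<open>\<delta> > 0\<close> by (intro powr_mono) auto
  note m = fast_embedding_moments[OF _ assms(1)]
  show ?thesis
  \<comment> \<open>As \<open>enn2real\<close> sends infinity to 0, the two growth bounds alone
    would not exclude infinite expectations; finiteness is shown separately.\<close>
  proof (intro conjI)
    show "\<forall>\<^sub>F n in sequentially. expect (M n) (tau_f (A n)) < \<infinity>"
      using ev by eventually_elim (intro m(1))
    show "\<forall>\<^sub>F n in sequentially. expect (M n) (\<lambda>\<omega>. \<bar>tau_f (A n) \<omega> - ereal (pi / 2)\<bar> ^ 2) < \<infinity>"
      using ev by eventually_elim (rule le_less_trans[OF m(3)], auto)
    show "(\<lambda>n. enn2real (expect (M n) (tau_f (A n))) - pi / 2) \<in> O(\<lambda>n. real n powr (\<delta> - 1 / 2))"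
    proof (rule bigoI[where c = "1 + ?C"], use ev in eventually_elim)
      case (elim n)
      have "\<bar>enn2real (expect (M n) (tau_f (A n))) - pi / 2\<bar> \<le> (1 + ?C) * real n powr (- 1 / 2)"
        using elim by (intro m(2))
      also have "\<dots> \<le> (1 + ?C) * real n powr (\<delta> - 1 / 2)"
        using powr[OF elim] by (intro mult_left_mono) (auto intro: add_nonneg_nonneg)
      finally show ?case by simp
    qed
    show "(\<lambda>n. enn2real (expect (M n) (\<lambda>\<omega>. \<bar>tau_f (A n) \<omega> - ereal (pi / 2)\<bar> ^ 2)))
      \<in> O(\<lambda>n. real n powr (\<delta> - 1 / 2))"
    proof (rule bigoI[where c = "?C"], use ev in eventually_elim)
      case (elim n)
      have "enn2real (expect (M n) (\<lambda>\<omega>. \<bar>tau_f (A n) \<omega> - ereal (pi / 2)\<bar> ^ 2))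
          \<le> enn2real (ennreal (?C * real n powr (- 1 / 2)))"
        using m(3)[OF elim elim] by (intro enn2real_mono) auto
      also have "\<dots> = ?C * real n powr (- 1 / 2)" by simp
      also have "\<dots> \<le> ?C * real n powr (\<delta> - 1 / 2)"
        using powr[OF elim] by (intro mult_left_mono) auto
      finally show ?case by simp
    qed
  qed
qed

end
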